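(* Let $A$ and $B$ be finite sets and let $X \subset A^{\mathbb{Z}}$ and $Y \subset B^{\mathbb{Z}}$ be subshifts of finite type. Suppose that the topological spaces underlying $X$ and $Y$ are homeomorphic. Then $X$ is injunctive if and only if $Y$ is injunctive.
   Context: For a finite set $A$, $A^{\mathbb{Z}}$ carries the product topology ($A$ discrete) and the shift homeomorphism $\sigma$, $(\sigma(x))_i = x_{i+1}$. A subshift is a closed subset $X\subset A^{\mathbb{Z}}$ with $\sigma(X)=X$. It is of finite type if there are an integer $n\ge 0$ and $S\subset A^n$ such that $X$ is the set of all $x\in A^{\mathbb{Z}}$ with $(x_{i+1},\dots,x_{i+n})\in S$ for all $i\in\mathbb{Z}$. An endomorphism of $X$ is a continuous map $\tau\colon X\to X$ commuting with $\sigma$. $X$ is injunctive if every surjective endomorphism of $X$ is injective. The homeomorphism between $X$ and $Y$ is not assumed to commute with the shifts. *)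

theory Defs
  imports "HOL-Analysis.Analysis"
begin

definition shift :: "(int \<Rightarrow> 'a) \<Rightarrow> (int \<Rightarrow> 'a)" where
  "shift x = (\<lambda>i. x (i + 1))"

definition full_shift :: "'a set \<Rightarrow> (int \<Rightarrow> 'a) topology" where
  "full_shift A = product_topology (\<lambda>_. discrete_topology A) UNIV"

definition subshift :: "'a set \<Rightarrow> (int \<Rightarrow> 'a) set \<Rightarrow> bool" where
  "subshift A X \<longleftrightarrow> closedin (full_shift A) X \<and> shift ` X = X"

(* Elements of A^n are represented by lists of length n with entries in A. *)
definition finite_type :: "'a set \<Rightarrow> (int \<Rightarrow> 'a) set \<Rightarrow> bool" where
  "finite_type A X \<longleftrightarrow>
     (\<exists>n S. S \<subseteq> {w. length w = n \<and> set w \<subseteq> A} \<and>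
        X = {x \<in> topspace (full_shift A).
               \<forall>i. map (\<lambda>k. x (i + int k)) [1..<Suc n] \<in> S})"

definition subshift_topology :: "'a set \<Rightarrow> (int \<Rightarrow> 'a) set \<Rightarrow> (int \<Rightarrow> 'a) topology" where
  "subshift_topology A X = subtopology (full_shift A) X"

(* Only the values of \<tau> on X matter. *)
definition endomorphism ::
  "'a set \<Rightarrow> (int \<Rightarrow> 'a) set \<Rightarrow> ((int \<Rightarrow> 'a) \<Rightarrow> (int \<Rightarrow> 'a)) \<Rightarrow> bool" where
  "endomorphism A X \<tau> \<longleftrightarrow>
     continuous_map (subshift_topology A X) (subshift_topology A X) \<tau> \<and>
     (\<forall>x\<in>X. \<tau> (shift x) = shift (\<tau> x))"

definition injunctive :: "'a set \<Rightarrow> (int \<Rightarrow> 'a) set \<Rightarrow> bool" where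
  "injunctive A X \<longleftrightarrow> (\<forall>\<tau>. endomorphism A X \<tau> \<and> \<tau> ` X = X \<longrightarrow> inj_on \<tau> X)"

end

theory Submission
  imports Defs "HOL-Library.Sublist"
begin

text \<open>
  For a subshift of finite type, injunctivity is equivalent to the finiteness of the set of
  non-isolated points, which is a topological invariant.

  If there are only finitely many non-isolated points, then compactness and expansivity leave only
  finitely many orbits. A surjective equivariant map permutes the orbits, and hence is injective.

  Conversely, pass to the space of bi-infinite walks on a finite graph. If some vertex \<open>v\<close> has two
  distinct successors leading back to \<open>v\<close>, the two loops at \<open>v\<close> yield two non-overlapping words that
  can be interchanged freely. Read as bits, they support the map replacing each bit by its sum
  with the next one, which is onto but not injective. Otherwise infinitely many non-isolated
  points force a walk that enters a cycle and later leaves it for good, and one may let it end in a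
  cycle \<open>C\<close> that cannot be left. Delaying or advancing the moment of entering \<open>C\<close> changes the number of
  turns around the preceding cycle, and advancing it whenever enough turns are left is onto but not
  injective.
\<close>

section \<open>Topology of subshifts\<close>

text \<open>Each of the two non-injective maps must be onto the whole shift, so the places where it
  acts have to remain recognisable in the image. This is why the two words must not overlap:
  interchanging them neither creates nor destroys an occurrence, and a preimage is found by a
  recursion on bits alone. Likewise, a walk that has one spare turn before entering \<open>C\<close>
  is the image of a walk that has two, and a walk that has none is left alone. Finite type enters
  through the graph: there, compatible windows taken from different points can be glued to a point
  of the subshift, which permits both kinds of exchange. In the finite case the danger is an
  infinite orbit mapped onto a finite one. It is excluded because the finite orbits are already
  permuted among themselves.\<close>

definition window_eq :: "int \<Rightarrow> (int \<Rightarrow> 'a) \<Rightarrow> (int \<Rightarrow> 'a) \<Rightarrow> bool" where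
  "window_eq N x y \<longleftrightarrow> (\<forall>k. \<bar>k\<bar> \<le> N \<longrightarrow> x k = y k)"

text \<open>The derived set of the space, that is, its first Cantor-Bendixson derivative.\<close>

definition nonisolated :: "'b topology \<Rightarrow> 'b set" where
  "nonisolated T = {x \<in> topspace T. \<not> openin T {x}}"

lemma topspace_full_shift: "topspace (full_shift A) = {x. range x \<subseteq> A}"
  by (auto simp: full_shift_def PiE_def)

text \<open>A basic open box constrains finitely many coordinates, so it contains a cylinder over a
  central window; such cylinders are themselves open boxes. From here on openness is a statement
  about windows.\<close>

lemma openin_subshift_topology:
  assumes X: "X \<subseteq> topspace (full_shift A)"
  shows "openin (subshift_topology A X) U \<longleftrightarrow>
    U \<subseteq> X \<and> (\<forall>x\<in>U. \<exists>N. \<forall>y\<in>X. window_eq N x y \<longrightarrow> y \<in> U)" (is "?L \<longleftrightarrow> ?R")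
proof
  assume ?L
  then obtain V where V: "openin (full_shift A) V" "U = V \<inter> X"
    by (auto simp: subshift_topology_def openin_subtopology)
  have "\<exists>N. \<forall>y\<in>X. window_eq N x y \<longrightarrow> y \<in> U" if x: "x \<in> U" for x
  proof -
    have "x \<in> V" using x V by auto
    then obtain W where W: "finite {i. W i \<noteq> A}" "x \<in> Pi\<^sub>E UNIV W" "Pi\<^sub>E UNIV W \<subseteq> V"
      using V(1) unfolding full_shift_def openin_product_topology_alt by auto
    obtain N where N: "\<And>i. i \<in> {i. W i \<noteq> A} \<Longrightarrow> \<bar>i\<bar> \<le> N"
      using W(1) by (metis (no_types, lifting) Max_ge finite_imageI imageI)
    have "y \<in> U" if y: "y \<in> X" "window_eq N x y" for y
    proof -
      have "y i \<in> W i" for i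
      proof (cases "W i = A")
        case True
        then show ?thesis using y(1) X by (auto simp: topspace_full_shift)
      next
        case False
        then have "x i = y i" using N y(2) by (auto simp: window_eq_def)
        then show ?thesis using W(2) by (metis PiE_mem UNIV_I)
      qed
      then have "y \<in> Pi\<^sub>E UNIV W" by auto
      then show ?thesis using W(3) V(2) y(1) by auto
    qed
    then show ?thesis by blast
  qed
  moreover have "U \<subseteq> X" using V by auto
  ultimately show ?R by blast
next
  assume R: ?R
  define cyl where "cyl x N = Pi\<^sub>E UNIV (\<lambda>i. if \<bar>i\<bar> \<le> N then {x i} else A)" for x and N :: int
  have cyl_open: "openin (full_shift A) (cyl x N)" if "x \<in> X" for x N
  proof -
    have "finite {i. (if \<bar>i\<bar> \<le> N then {x i} else A) \<noteq> A}"
      by (rule finite_subset[of _ "{-N..N}"]) auto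
    moreover have "x i \<in> A" for i using that X by (auto simp: topspace_full_shift)
    ultimately show ?thesis
      unfolding full_shift_def cyl_def by (intro product_topology_basis) auto
  qed
  have cyl_iff: "y \<in> cyl x N \<longleftrightarrow> window_eq N x y" if "y \<in> X" for x y N
    using that X by (auto simp: cyl_def window_eq_def topspace_full_shift PiE_iff split: if_splits)
  have "openin (subshift_topology A X) U"
  proof (subst openin_subopen, intro ballI)
    fix x assume x: "x \<in> U"
    then obtain N where N: "\<forall>y\<in>X. window_eq N x y \<longrightarrow> y \<in> U" using R by blast
    have xX: "x \<in> X" using x R by blast
    have "openin (subshift_topology A X) (cyl x N \<inter> X)"
      unfolding subshift_topology_def using cyl_open[OF xX] by (rule openin_subtopology_Int)
    moreover have "x \<in> cyl x N \<inter> X" using xX cyl_iff by (auto simp: window_eq_def)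
    moreover have "cyl x N \<inter> X \<subseteq> U" using N cyl_iff by auto
    ultimately show "\<exists>T. openin (subshift_topology A X) T \<and> x \<in> T \<and> T \<subseteq> U" by blast
  qed
  then show ?L .
qed

lemma topspace_subshift_topology:
  "X \<subseteq> topspace (full_shift A) \<Longrightarrow> topspace (subshift_topology A X) = X"
  by (auto simp: subshift_topology_def)

lemma nonisolated_subshift_topology:
  assumes "X \<subseteq> topspace (full_shift A)"
  shows "nonisolated (subshift_topology A X) =
    {x \<in> X. \<forall>N. \<exists>y\<in>X. y \<noteq> x \<and> window_eq N x y}"
  unfolding nonisolated_def topspace_subshift_topology[OF assms] openin_subshift_topology[OF assms]
  by blast

lemma finite_nonisolated_homeomorphic:
  assumes "S homeomorphic_space T"
  shows "finite (nonisolated S) \<longleftrightarrow> finite (nonisolated T)"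
proof -
  obtain f where f: "homeomorphic_map S T f" using assms homeomorphic_space by blast
  have inj: "inj_on f (topspace S)" and im: "f ` topspace S = topspace T"
    using f by (auto simp: homeomorphic_map_def homeomorphic_imp_injective_map homeomorphic_imp_surjective_map)
  have "openin T {f x} \<longleftrightarrow> openin S {x}" if "x \<in> topspace S" for x
    using homeomorphic_map_openness[OF f, of "{x}"] that by auto
  then have "nonisolated T = f ` nonisolated S"
    unfolding nonisolated_def using im by (auto 4 4)
  moreover have "inj_on f (nonisolated S)" using inj by (rule inj_on_subset) (auto simp: nonisolated_def)
  ultimately show ?thesis by (simp add: finite_image_iff)
qed

text \<open>The Curtis-Hedlund-Lyndon form of an endomorphism: one radius \<open>M\<close> serves
  all positions \<open>i\<close>.\<close>

definition sliding_block_endo :: "(int \<Rightarrow> 'a) set \<Rightarrow> ((int \<Rightarrow> 'a) \<Rightarrow> (int \<Rightarrow> 'a)) \<Rightarrow> bool" where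
  "sliding_block_endo X \<tau> \<longleftrightarrow> \<tau> ` X \<subseteq> X \<and> (\<forall>x\<in>X. \<tau> (shift x) = shift (\<tau> x)) \<and>
     (\<exists>M. \<forall>x\<in>X. \<forall>y\<in>X. \<forall>i. (\<forall>k. \<bar>k - i\<bar> \<le> M \<longrightarrow> x k = y k) \<longrightarrow> \<tau> x i = \<tau> y i)"

text \<open>Continuity: the image on the window of radius \<open>N\<close> is determined by the
  argument on the window of radius \<open>N + M\<close>.\<close>

lemma sliding_block_endo_imp_endomorphism:
  assumes X: "X \<subseteq> topspace (full_shift A)" and \<tau>: "sliding_block_endo X \<tau>"
  shows "endomorphism A X \<tau>"
proof -
  obtain M where M: "\<And>x y i. x \<in> X \<Longrightarrow> y \<in> X \<Longrightarrow> (\<And>k. \<bar>k - i\<bar> \<le> M \<Longrightarrow> x k = y k) \<Longrightarrow> \<tau> x i = \<tau> y i"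
    using \<tau> unfolding sliding_block_endo_def by metis
  have "openin (subshift_topology A X) {x \<in> X. \<tau> x \<in> U}" if U: "openin (subshift_topology A X) U" for U
    unfolding openin_subshift_topology[OF X]
  proof (intro conjI ballI)
    fix x assume "x \<in> {x \<in> X. \<tau> x \<in> U}"
    then have x: "x \<in> X" "\<tau> x \<in> U" by auto
    then obtain N where N: "\<And>y. y \<in> X \<Longrightarrow> window_eq N (\<tau> x) y \<Longrightarrow> y \<in> U"
      using U unfolding openin_subshift_topology[OF X] by meson
    have "\<tau> y \<in> U" if y: "y \<in> X" "window_eq (N + M) x y" for y
    proof (rule N)
      show "\<tau> y \<in> X" using \<tau> y(1) by (auto simp: sliding_block_endo_def)
      have "\<tau> x i = \<tau> y i" if "\<bar>i\<bar> \<le> N" for i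
      proof (rule M[OF x(1) y(1)])
        fix k assume "\<bar>k - i\<bar> \<le> M"
        then have "\<bar>k\<bar> \<le> N + M" using that by linarith
        then show "x k = y k" using y(2) by (simp add: window_eq_def)
      qed
      then show "window_eq N (\<tau> x) (\<tau> y)" by (simp add: window_eq_def)
    qed
    then show "\<exists>N. \<forall>y\<in>X. window_eq N x y \<longrightarrow> y \<in> {x \<in> X. \<tau> x \<in> U}" by blast
  qed auto
  then show ?thesis
    using \<tau> by (auto simp: endomorphism_def continuous_map_def topspace_subshift_topology[OF X] sliding_block_endo_def)
qed

section \<open>Integer powers of the shift\<close>

definition shift_by :: "int \<Rightarrow> (int \<Rightarrow> 'a) \<Rightarrow> int \<Rightarrow> 'a" where
  "shift_by n x = (\<lambda>k. x (k + n))"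

text \<open>The last equation makes the simplifier eliminate \<open>shift\<close>, so that composing
  shifts becomes adding exponents.\<close>

lemma shift_by_simps [simp]:
  "shift_by 0 x = x" "shift_by m (shift_by n x) = shift_by (m + n) x"
  "shift x = shift_by 1 x"
  by (auto simp: shift_by_def shift_def algebra_simps)

lemma shift_by_mem:
  assumes "shift ` X = X" "x \<in> X"
  shows "shift_by n x \<in> X"
proof -
  have "shift_by (int m) x \<in> X \<and> shift_by (- int m) x \<in> X" for m
  proof (induction m)
    case 0
    then show ?case using assms by simp
  next
    case (Suc m)
    have "shift (shift_by (int m) x) \<in> X" using Suc assms(1) by blast
    \<comment> \<open>Backward steps rest on the inclusion of \<open>X\<close> in its image under
      \<open>shift\<close>: the preimage found in \<open>X\<close> is the backward shift, as
      \<open>shift\<close> is injective on all sequences.\<close>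
    moreover obtain y where y: "y \<in> X" "shift_by (- int m) x = shift y" using Suc assms(1) by blast
    have "shift_by (-1) (shift_by (- int m) x) = y" unfolding y by simp
    then have "shift_by (- int (Suc m)) x = y" by simp
    ultimately show ?case using y(1) by (simp add: add.commute)
  qed
  then show ?thesis by (metis int_cases2)
qed

lemma equivariant_shift_by:
  assumes X: "shift ` X = X" and \<tau>: "\<forall>x\<in>X. \<tau> (shift x) = shift (\<tau> x)" and x: "x \<in> X"
  shows "\<tau> (shift_by n x) = shift_by n (\<tau> x)"
proof -
  have pos: "\<tau> (shift_by (int m) y) = shift_by (int m) (\<tau> y)" if "y \<in> X" for m y
  proof (induction m)
    case (Suc m)
    have "\<tau> (shift (shift_by (int m) y)) = shift (\<tau> (shift_by (int m) y))"
      using shift_by_mem[OF X that] \<tau> by blast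
    then show ?case using Suc by (simp add: add.commute)
  qed simp
  show ?thesis
  proof (cases n)
    case (nonneg m)
    then show ?thesis using pos[OF x] by simp
  next
    case (neg m)
    have "\<tau> (shift_by (int (Suc m)) (shift_by n x)) = shift_by (int (Suc m)) (\<tau> (shift_by n x))"
      using pos shift_by_mem[OF X x] by blast
    then have "shift_by n (\<tau> x) = shift_by n (shift_by (int (Suc m)) (\<tau> (shift_by n x)))"
      using neg by simp
    then show ?thesis using neg by simp
  qed
qed

section \<open>Finitely many non-isolated points\<close>

lemma shift_closed_nonisolated:
  assumes X: "X \<subseteq> topspace (full_shift A)" "shift ` X = X"
    and x: "x \<in> nonisolated (subshift_topology A X)"
  shows "shift_by n x \<in> nonisolated (subshift_topology A X)"
  unfolding nonisolated_subshift_topology[OF X(1)]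
proof (intro CollectI conjI allI)
  have x': "x \<in> X" "\<And>N. \<exists>y\<in>X. y \<noteq> x \<and> window_eq N x y"
    using x unfolding nonisolated_subshift_topology[OF X(1)] by auto
  show "shift_by n x \<in> X" using shift_by_mem[OF X(2) x'(1)] .
  fix N
  obtain y where y: "y \<in> X" "y \<noteq> x" "window_eq (N + \<bar>n\<bar>) x y" using x'(2) by blast
  have "shift_by n y \<noteq> shift_by n x"
  proof
    assume "shift_by n y = shift_by n x"
    then have "shift_by (-n) (shift_by n y) = shift_by (-n) (shift_by n x)" by (simp only:)
    then show False using y(2) by simp
  qed
  moreover have "window_eq N (shift_by n x) (shift_by n y)"
    using y(3) by (auto simp: window_eq_def shift_by_def)
  ultimately show "\<exists>y\<in>X. y \<noteq> shift_by n x \<and> window_eq N (shift_by n x) y"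
    using shift_by_mem[OF X(2) y(1)] by blast
qed

lemma compact_space_subshift_topology:
  assumes "finite A" "subshift A X"
  shows "compact_space (subshift_topology A X)"
proof -
  have "compact_space (full_shift A)"
    using assms(1) by (auto simp: full_shift_def compact_space_product_topology compact_space_discrete_topology)
  then show ?thesis
    using assms(2) closedin_compact_space compact_space_subtopology
    unfolding subshift_topology_def subshift_def by blast
qed

text \<open>All points outside \<open>U\<close> are isolated, so \<open>U\<close> and their
  singletons form an open cover, and a subcover cannot omit any of these singletons.\<close>

lemma finite_complement_of_neighbourhood_of_nonisolated:
  assumes "compact_space T" "openin T U" "nonisolated T \<subseteq> U"
  shows "finite (topspace T - U)"
proof -
  let ?\<U> = "insert U ((\<lambda>x. {x}) ` (topspace T - U))"
  have "\<forall>V\<in>?\<U>. openin T V" "topspace T \<subseteq> \<Union>?\<U>"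
    using assms(2,3) by (auto simp: nonisolated_def)
  then have "\<exists>\<F>. finite \<F> \<and> \<F> \<subseteq> ?\<U> \<and> topspace T \<subseteq> \<Union>\<F>"
    using assms(1) unfolding compact_space_alt by meson
  then obtain \<F> where \<F>: "finite \<F>" "\<F> \<subseteq> insert U ((\<lambda>x. {x}) ` (topspace T - U))" "topspace T \<subseteq> \<Union>\<F>"
    by blast
  have "topspace T - U \<subseteq> \<Union>(\<F> - {U})" using \<F> by blast
  moreover have "finite (\<Union>(\<F> - {U}))" using \<F> by auto
  ultimately show ?thesis by (rule finite_subset)
qed

definition orbit_of :: "(int \<Rightarrow> 'a) \<Rightarrow> (int \<Rightarrow> 'a) set" where
  "orbit_of x = range (\<lambda>n. shift_by n x)"

lemma mem_orbit_of [simp]: "x \<in> orbit_of x"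
  unfolding orbit_of_def by (metis rangeI shift_by_simps(1))

lemma orbit_of_eq: "y \<in> orbit_of x \<Longrightarrow> orbit_of y = orbit_of x"
proof -
  assume "y \<in> orbit_of x"
  then obtain n where n: "y = shift_by n x" by (auto simp: orbit_of_def)
  have "shift_by m x = shift_by (m - n) y" for m using n by simp
  then have "orbit_of x \<subseteq> orbit_of y" unfolding orbit_of_def by blast
  moreover have "orbit_of y \<subseteq> orbit_of x" unfolding orbit_of_def n by auto
  ultimately show ?thesis by blast
qed

lemma finite_separating_window:
  assumes "finite (F :: (int \<Rightarrow> 'a) set)"
  obtains N where "\<And>p q. p \<in> F \<Longrightarrow> q \<in> F \<Longrightarrow> window_eq N p q \<Longrightarrow> p = q"
proof -
  \<comment> \<open>A coordinate where \<open>p\<close> and \<open>q\<close> differ; for equal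
    sequences the choice is arbitrary, which can only enlarge the maximum \<open>N\<close>.\<close>
  define d where "d p q = \<bar>SOME k :: int. (p :: int \<Rightarrow> 'a) k \<noteq> q k\<bar>" for p q
  define N where "N = Max ((\<lambda>(p, q). d p q) ` (F \<times> F))"
  have "p = q" if "p \<in> F" "q \<in> F" "window_eq N p q" for p q
  proof (rule ccontr)
    assume "p \<noteq> q"
    then have "\<exists>k. p k \<noteq> q k" by auto
    then have "p (SOME k. p k \<noteq> q k) \<noteq> q (SOME k. p k \<noteq> q k)" by (rule someI_ex)
    moreover have "d p q \<le> N" unfolding N_def
      by (rule Max_ge) (use assms that in \<open>auto intro!: image_eqI[of _ _ "(p, q)"]\<close>)
    ultimately show False using that(3) by (auto simp: window_eq_def d_def)
  qed
  then show ?thesis using that by blast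
qed

text \<open>By expansivity, an orbit that stays close to the finite invariant set of non-isolated points
  lies in it; all other orbits meet the finite complement of a neighbourhood.\<close>

lemma finite_orbits_if_finite_nonisolated:
  assumes A: "finite A" "subshift A X" and fin: "finite (nonisolated (subshift_topology A X))"
  shows "finite (orbit_of ` X)"
proof -
  let ?F = "nonisolated (subshift_topology A X)"
  have X: "X \<subseteq> topspace (full_shift A)" "shift ` X = X"
    using A closedin_subset by (auto simp: subshift_def)
  have FX: "?F \<subseteq> X" by (auto simp: nonisolated_def topspace_subshift_topology[OF X(1)])
  obtain N where N: "\<And>p q. p \<in> ?F \<Longrightarrow> q \<in> ?F \<Longrightarrow> window_eq N p q \<Longrightarrow> p = q"
    using finite_separating_window[OF fin] by metis
  \<comment> \<open>The extra coordinate allows comparison after one shift; the absolute value keeps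
    coordinate 0 inside the window even if \<open>N\<close> is negative.\<close>
  define M where "M = \<bar>N\<bar> + 1"
  define U where "U = {x \<in> X. \<exists>p\<in>?F. window_eq M x p}"
  have "openin (subshift_topology A X) U"
    unfolding openin_subshift_topology[OF X(1)]
  proof (intro conjI ballI)
    fix x assume "x \<in> U"
    then obtain p where p: "p \<in> ?F" "window_eq M x p" by (auto simp: U_def)
    have "y \<in> U" if "y \<in> X" "window_eq M x y" for y
      using that p by (auto simp: U_def window_eq_def intro!: bexI[of _ p])
    then show "\<exists>N. \<forall>y\<in>X. window_eq N x y \<longrightarrow> y \<in> U" by blast
  qed (auto simp: U_def)
  moreover have "?F \<subseteq> U" using FX by (auto simp: U_def window_eq_def)
  ultimately have K: "finite (X - U)"
    using finite_complement_of_neighbourhood_of_nonisolated[OF compact_space_subshift_topology[OF A]]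
    by (simp add: topspace_subshift_topology[OF X(1)])
  have "orbit_of x \<in> orbit_of ` (?F \<union> (X - U))" if x: "x \<in> X" for x
  proof (cases "\<forall>n. shift_by n x \<in> U")
    case False
    then obtain n where "shift_by n x \<in> X - U" using shift_by_mem[OF X(2) x] by blast
    moreover have "orbit_of x = orbit_of (shift_by n x)"
      by (rule orbit_of_eq[symmetric]) (auto simp: orbit_of_def)
    ultimately show ?thesis by blast
  next
    case True
    then have "\<forall>n. \<exists>p\<in>?F. window_eq M (shift_by n x) p" by (simp add: U_def)
    then obtain p where p: "\<And>n. p n \<in> ?F" "\<And>n. window_eq M (shift_by n x) (p n)" by metis
    \<comment> \<open>Both sides are non-isolated and agree with the same part of \<open>x\<close>
      on the window of radius \<open>N\<close>, which separates non-isolated points.\<close>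
    have step: "p (n + 1) = shift_by 1 (p n)" for n
    proof (rule N[OF p(1) shift_closed_nonisolated[OF X p(1)]])
      have "p (n + 1) k = p n (k + 1)" if "\<bar>k\<bar> \<le> N" for k
      proof -
        have "p (n + 1) k = x (k + (n + 1))" using p(2)[of "n + 1"] that
          by (auto simp: window_eq_def shift_by_def M_def)
        moreover have "p n (k + 1) = x (k + 1 + n)" using p(2)[of n] that
          by (auto simp: window_eq_def shift_by_def M_def)
        ultimately show ?thesis by (simp add: algebra_simps)
      qed
      then show "window_eq N (p (n + 1)) (shift_by 1 (p n))" by (simp add: window_eq_def shift_by_def)
    qed
    have pn: "p n = shift_by n (p 0)" for n
    proof (induction n rule: int_induct[of _ 0])
      case (step1 i)
      then show ?case using step[of i] by (simp add: add.commute)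
    next
      case (step2 i)
      have "shift_by (-1) (p (i - 1 + 1)) = p (i - 1)" unfolding step by simp
      then show ?case using step2 by simp
    qed simp
    \<comment> \<open>Near time \<open>n\<close> the point \<open>x\<close> looks like
      \<open>p n\<close>, the \<open>n\<close>-fold shift of \<open>p 0\<close>; comparing
      coordinate 0 for every \<open>n\<close> recovers all of \<open>x\<close>.\<close>
    have "x n = p 0 n" for n
    proof -
      have "shift_by n x 0 = p n 0" using p(2)[of n] by (simp add: window_eq_def M_def)
      also have "\<dots> = shift_by n (p 0) 0" using pn[of n] by simp
      finally show ?thesis by (simp add: shift_by_def)
    qed
    then have "x = p 0" by (rule ext)
    then have "x \<in> ?F" using p(1)[of 0] by simp
    then show ?thesis by blast
  qed
  then have "orbit_of ` X \<subseteq> orbit_of ` (?F \<union> (X - U))" by blast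
  then show ?thesis using fin K by (meson finite_UnI finite_imageI finite_subset)
qed

lemma finite_orbit_if_periodic:
  assumes "shift_by n x = x" "n \<noteq> 0"
  shows "finite (orbit_of x)"
proof -
  have pos: "shift_by (int m * n) x = x" for m
  proof (induction m)
    case (Suc m)
    have "int (Suc m) * n = n + int m * n" by (simp add: algebra_simps)
    then have "shift_by (int (Suc m) * n) x = shift_by n (shift_by (int m * n) x)" by simp
    then show ?case using Suc assms by simp
  qed simp
  have mult: "shift_by (m * n) x = x" for m
  proof (cases m)
    case (neg k)
    have "shift_by (m * n) (shift_by (int (Suc k) * n) x) = x"
      using neg by (simp flip: distrib_right)
    then show ?thesis unfolding pos .
  qed (use pos in auto)
  have "shift_by k x = shift_by (k mod n) x" for k
  proof -
    have "shift_by k x = shift_by (k mod n) (shift_by (k div n * n) x)" by simp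
    then show ?thesis unfolding mult .
  qed
  \<comment> \<open>The interval is symmetric because \<open>mod\<close> takes the sign of
    \<open>n\<close>, which may be negative.\<close>
  moreover have "k mod n \<in> {-\<bar>n\<bar>..\<bar>n\<bar>}" for k
    using abs_mod_less[OF assms(2), of k] by auto
  ultimately have "orbit_of x \<subseteq> (\<lambda>k. shift_by k x) ` {-\<bar>n\<bar>..\<bar>n\<bar>}"
    unfolding orbit_of_def by blast
  then show ?thesis by (rule finite_subset) simp
qed

text \<open>A surjection of the finite set of orbits onto itself is a bijection. It sends finite
  orbits to finite ones, hence permutes them, and the finite union of these is mapped bijectively.
  Two points of an infinite orbit with equal images would make the image orbit finite, but a finite
  orbit already comes from a finite one.\<close>

lemma surjective_equivariant_injective_if_finite_orbits:
  assumes X: "shift ` X = X" and fin: "finite (orbit_of ` X)"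
    and \<tau>: "\<forall>x\<in>X. \<tau> (shift x) = shift (\<tau> x)" and surj: "\<tau> ` X = X"
  shows "inj_on \<tau> X"
proof -
  let ?O = "orbit_of ` X"
  have orb: "\<tau> ` orbit_of x = orbit_of (\<tau> x)" if "x \<in> X" for x
    using equivariant_shift_by[OF X \<tau> that] by (auto simp: orbit_of_def image_image)
  have "(`) \<tau> ` ?O = ?O"
  proof -
    have "(`) \<tau> ` ?O = orbit_of ` (\<tau> ` X)" using orb by (auto simp: image_image)
    then show ?thesis using surj by simp
  qed
  then have inj: "inj_on ((`) \<tau>) ?O" using fin by (simp add: eq_card_imp_inj_on)
  define Q where "Q = {S \<in> ?O. finite S}"
  have "(`) \<tau> ` Q \<subseteq> Q" using orb surj by (force simp: Q_def)
  moreover have "finite Q" "inj_on ((`) \<tau>) Q" using fin inj by (auto simp: Q_def inj_on_def)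
  ultimately have Q: "(`) \<tau> ` Q = Q" using endo_inj_surj by blast
  have "\<tau> ` \<Union>Q = \<Union>((`) \<tau> ` Q)" by blast
  then have "\<tau> ` \<Union>Q = \<Union>Q" using Q by simp
  moreover have "finite (\<Union>Q)" using \<open>finite Q\<close> by (auto simp: Q_def)
  ultimately have inj_per: "inj_on \<tau> (\<Union>Q)" by (simp add: eq_card_imp_inj_on)
  show ?thesis
  proof (rule inj_onI)
    fix x y assume xy: "x \<in> X" "y \<in> X" "\<tau> x = \<tau> y"
    have "\<tau> ` orbit_of x = \<tau> ` orbit_of y" using orb xy by simp
    then have eq: "orbit_of x = orbit_of y" using inj xy by (auto simp: inj_on_def)
    show "x = y"
    proof (cases "finite (orbit_of x)")
      case True
      then have "orbit_of x \<in> Q" using xy(1) by (simp add: Q_def)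
      then have "x \<in> \<Union>Q" "y \<in> \<Union>Q" using eq mem_orbit_of by blast+
      then show ?thesis using inj_per xy(3) by (auto simp: inj_on_def)
    next
      case False
      obtain n where n: "y = shift_by n x"
        using eq mem_orbit_of[of y] by (auto simp: orbit_of_def)
      have "n = 0"
      proof (rule ccontr)
        assume "n \<noteq> 0"
        moreover have "shift_by n (\<tau> x) = \<tau> x"
          using equivariant_shift_by[OF X \<tau> xy(1), of n] n xy(3) by metis
        ultimately have "finite (orbit_of (\<tau> x))" by (rule finite_orbit_if_periodic[rotated])
        moreover have "\<tau> x \<in> X" using surj xy(1) by blast
        ultimately have "orbit_of (\<tau> x) \<in> (`) \<tau> ` Q" unfolding Q by (auto simp: Q_def)
        then obtain S where S: "S \<in> Q" "\<tau> ` S = \<tau> ` orbit_of x" using orb[OF xy(1)] by auto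
        then have "S = orbit_of x" using inj xy(1) by (auto simp: Q_def inj_on_def)
        then show False using False S(1) by (simp add: Q_def)
      qed
      then show ?thesis using n by simp
    qed
  qed
qed

lemma injunctive_if_finite_nonisolated:
  assumes "finite A" "subshift A X" "finite (nonisolated (subshift_topology A X))"
  shows "injunctive A X"
  unfolding injunctive_def endomorphism_def
  using surjective_equivariant_injective_if_finite_orbits finite_orbits_if_finite_nonisolated[OF assms]
    assms(2) by (auto simp only: subshift_def)

section \<open>Sums of adjacent blocks\<close>

text \<open>The vertex shift of the graph.\<close>

definition walks :: "('v \<times> 'v) set \<Rightarrow> (int \<Rightarrow> 'v) set" where
  "walks E = {x. \<forall>i. (x i, x (i + 1)) \<in> E}"

text \<open>A combinatorial witness against injunctivity, free of topology so that it can be carried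
  from the graph back to the subshift.\<close>

definition collapsible :: "(int \<Rightarrow> 'a) set \<Rightarrow> bool" where
  "collapsible X \<longleftrightarrow> (\<exists>\<tau>. sliding_block_endo X \<tau> \<and> \<tau> ` X = X \<and> \<not> inj_on \<tau> X)"

lemma xor_antiderivative:
  fixes d :: "int \<Rightarrow> bool"
  shows "\<exists>g. \<forall>q. g q = (d q \<noteq> g (q + 1))"
proof -
  define u where "u = rec_nat False (\<lambda>n b. b \<noteq> d (int n))"
  define l where "l = rec_nat False (\<lambda>n b. b \<noteq> d (- int n - 1))"
  define g where "g q = (if q \<ge> 0 then u (nat q) else l (nat (- q)))" for q
  have "g q = (d q \<noteq> g (q + 1))" for q
  proof (cases "q \<ge> 0")
    case True
    then have "nat (q + 1) = Suc (nat q)" by simp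
    then show ?thesis using True by (auto simp: g_def u_def)
  next
    case False
    then have "nat (- q) = Suc (nat (- (q + 1)))" by simp
    moreover have "l 0 = u 0" by (simp add: l_def u_def)
    ultimately show ?thesis using False by (cases "q = -1") (auto simp: g_def l_def)
  qed
  then show ?thesis by blast
qed

text \<open>If \<open>B\<close> fails somewhere to the right of \<open>q\<close>, the recursion
  stops there and \<open>c q\<close> is a finite sum of values of \<open>d\<close>. If it never
  fails, every gate ahead is open and the ungated solution serves. When \<open>B (q + 1)\<close>
  holds, \<open>q\<close> and \<open>q + 1\<close> fall under the same case.\<close>

lemma gated_xor_antiderivative_unit:
  fixes B d :: "int \<Rightarrow> bool"
  shows "\<exists>c. \<forall>q. c q = (d q \<noteq> (B (q + 1) \<and> c (q + 1)))"
proof -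
  obtain g where g: "\<And>q. g q = (d q \<noteq> g (q + 1))" using xor_antiderivative[of d] by blast
  \<comment> \<open>\<open>R m q\<close> is the sum modulo 2 of \<open>d\<close> over the
    \<open>m\<close> positions starting at \<open>q\<close>.\<close>
  define R where "R = rec_nat (\<lambda>q. False) (\<lambda>n f q. d q \<noteq> f (q + 1 :: int))"
  have R: "R 0 q = False" "R (Suc n) q = (d q \<noteq> R n (q + 1))" for n q by (auto simp: R_def)
  define ends where "ends q n \<longleftrightarrow> \<not> B (q + 1 + int n)" for q n
  define c where "c q = (if \<exists>n. ends q n then R (Suc (LEAST n. ends q n)) q else g q)" for q
  have "c q = (d q \<noteq> (B (q + 1) \<and> c (q + 1)))" for q
  proof (cases "B (q + 1)")
    case False
    then have "ends q 0" by (simp add: ends_def)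
    then show ?thesis using False by (auto simp: c_def R)
  next
    case True
    have ends_Suc: "ends q (Suc n) = ends (q + 1) n" for n by (simp add: ends_def algebra_simps)
    have ends_0: "\<not> ends q 0" using True by (simp add: ends_def)
    have ex: "(\<exists>n. ends q n) = (\<exists>n. ends (q + 1) n)"
      using ends_Suc ends_0 by (metis not0_implies_Suc)
    show ?thesis
    proof (cases "\<exists>n. ends q n")
      case True
      then have "(LEAST n. ends q n) = Suc (LEAST n. ends q (Suc n))"
        using ends_0 by (metis Least_Suc)
      then show ?thesis using True ex \<open>B (q + 1)\<close> ends_Suc by (simp add: c_def R)
    next
      case False
      then show ?thesis using ex \<open>B (q + 1)\<close> g[of q] by (simp add: c_def)
    qed
  qed
  then show ?thesis by blast
qed

text \<open>The equation links only positions congruent modulo \<open>l\<close>, so each residue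
  class is a copy of the case of step 1.\<close>

lemma gated_xor_antiderivative:
  fixes B d :: "int \<Rightarrow> bool" and l :: int
  assumes "l > 0"
  shows "\<exists>c. \<forall>i. c i = (d i \<noteq> (B (i + l) \<and> c (i + l)))"
proof -
  have "\<exists>c. \<forall>q. c q = (d (r + q * l) \<noteq> (B (r + (q + 1) * l) \<and> c (q + 1)))" for r
    by (rule gated_xor_antiderivative_unit)
  then obtain c where c: "\<And>r q. c r q = (d (r + q * l) \<noteq> (B (r + (q + 1) * l) \<and> c r (q + 1)))" by metis
  have "c (i mod l) (i div l) = (d i \<noteq> (B (i + l) \<and> c ((i + l) mod l) ((i + l) div l)))" for i
  proof -
    have "i mod l + i div l * l = i" by simp
    moreover from this have "i mod l + (i div l + 1) * l = i + l" by (simp add: algebra_simps)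
    moreover have "(i + l) mod l = i mod l" "(i + l) div l = i div l + 1" using assms by auto
    ultimately show ?thesis using c[of "i mod l" "i div l"] by simp
  qed
  then show ?thesis by (intro exI[of _ "\<lambda>i. c (i mod l) (i div l)"]) blast
qed

text \<open>A block has \<open>l + 1\<close> vertices and both of its ends are \<open>v\<close>. Two
  occurrences may therefore abut, sharing one \<open>v\<close>, at distance exactly
  \<open>l\<close>; \<open>no_overlap\<close> forbids every smaller positive distance.\<close>

locale block_pair =
  fixes E :: "('v \<times> 'v) set" and D :: "bool \<Rightarrow> int \<Rightarrow> 'v" and l :: int and v :: 'v
  assumes l_pos: "l > 0"
    and D_edge: "\<And>b t. 0 \<le> t \<Longrightarrow> t < l \<Longrightarrow> (D b t, D b (t + 1)) \<in> E"
    and D_start: "\<And>b. D b 0 = v" and D_end: "\<And>b. D b l = v"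
    and no_overlap: "\<And>x b c i j. (\<And>t. 0 \<le> t \<Longrightarrow> t \<le> l \<Longrightarrow> x (i + t) = D b t) \<Longrightarrow>
       (\<And>t. 0 \<le> t \<Longrightarrow> t \<le> l \<Longrightarrow> x (j + t) = D c t) \<Longrightarrow> i \<le> j \<Longrightarrow> j < i + l \<Longrightarrow> i = j \<and> b = c"
begin

definition occ :: "bool \<Rightarrow> (int \<Rightarrow> 'v) \<Rightarrow> int \<Rightarrow> bool" where
  "occ b x i \<longleftrightarrow> (\<forall>t. 0 \<le> t \<longrightarrow> t \<le> l \<longrightarrow> x (i + t) = D b t)"

definition blk :: "(int \<Rightarrow> 'v) \<Rightarrow> int \<Rightarrow> bool" where
  "blk x i \<longleftrightarrow> (\<exists>b. occ b x i)"

text \<open>Blocks are taken half-open so that abutting ones are disjoint. The end vertex belongs to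
  the next block or stays as it is; it is \<open>v\<close> either way.\<close>

definition rewrite_blocks :: "(int \<Rightarrow> 'v) \<Rightarrow> (int \<Rightarrow> bool) \<Rightarrow> int \<Rightarrow> 'v" where
  "rewrite_blocks x \<beta> k = (if \<exists>i. i \<le> k \<and> k < i + l \<and> blk x i
     then let i = (THE i. i \<le> k \<and> k < i + l \<and> blk x i) in D (\<beta> i) (k - i) else x k)"

lemma occ_overlap: "occ b x i \<Longrightarrow> occ c x j \<Longrightarrow> i < j + l \<Longrightarrow> j < i + l \<Longrightarrow> i = j \<and> b = c"
  using no_overlap[of x i b j c] no_overlap[of x j c i b] unfolding occ_def by (metis linorder_le_cases)

lemma blk_overlap: "blk x i \<Longrightarrow> blk x j \<Longrightarrow> i < j + l \<Longrightarrow> j < i + l \<Longrightarrow> i = j"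
  using occ_overlap unfolding blk_def by blast

lemma rewrite_inside':
  assumes "blk x i" "0 \<le> t" "t < l"
  shows "rewrite_blocks x \<beta> (i + t) = D (\<beta> i) t"
proof -
  have ex: "\<exists>j. j \<le> i + t \<and> i + t < j + l \<and> blk x j" using assms by (intro exI[of _ i]) auto
  have "(THE j. j \<le> i + t \<and> i + t < j + l \<and> blk x j) = i"
    by (rule the_equality) (use assms blk_overlap[OF assms(1)] in force)+
  then show ?thesis using ex by (simp add: rewrite_blocks_def)
qed

lemma rewrite_outside:
  assumes "\<And>i. i \<le> k \<Longrightarrow> k < i + l \<Longrightarrow> \<not> blk x i"
  shows "rewrite_blocks x \<beta> k = x k"
  using assms by (auto simp: rewrite_blocks_def)

lemma blk_start: "blk x i \<Longrightarrow> x i = v"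
  using l_pos D_start by (fastforce simp: blk_def occ_def dest: spec[of _ 0])

lemma blk_end: "blk x i \<Longrightarrow> x (i + l) = v"
  using l_pos D_end by (fastforce simp: blk_def occ_def)

lemma rewrite_start: "blk x i \<Longrightarrow> rewrite_blocks x \<beta> i = v"
  using rewrite_inside'[of x i 0 \<beta>] l_pos D_start by simp

lemma rewrite_boundary:
  assumes "\<And>i. i < k \<Longrightarrow> k < i + l \<Longrightarrow> \<not> blk x i"
  shows "rewrite_blocks x \<beta> k = x k"
proof (cases "blk x k")
  case True
  then show ?thesis using rewrite_start blk_start by simp
next
  case False
  then show ?thesis using assms by (intro rewrite_outside) (metis order_le_less)
qed

lemma rewrite_inside:
  assumes "blk x i" "0 \<le> t" "t \<le> l"
  shows "rewrite_blocks x \<beta> (i + t) = D (\<beta> i) t"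
proof (cases "t < l")
  case True
  then show ?thesis using rewrite_inside' assms by blast
next
  case False
  then have t: "t = l" using assms by simp
  have "rewrite_blocks x \<beta> (i + l) = x (i + l)"
    by (rule rewrite_boundary) (use blk_overlap[OF assms(1)] in force)
  then show ?thesis using t blk_end[OF assms(1)] D_end by simp
qed

lemma rewrite_walks:
  assumes "x \<in> walks E"
  shows "rewrite_blocks x \<beta> \<in> walks E"
  unfolding walks_def
proof (intro CollectI allI)
  fix k
  show "(rewrite_blocks x \<beta> k, rewrite_blocks x \<beta> (k + 1)) \<in> E"
  proof (cases "\<exists>i. i \<le> k \<and> k < i + l \<and> blk x i")
    case True
    then obtain i where i: "i \<le> k" "k < i + l" "blk x i" by blast
    then have "rewrite_blocks x \<beta> k = D (\<beta> i) (k - i)"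
      "rewrite_blocks x \<beta> (k + 1) = D (\<beta> i) (k - i + 1)"
      using rewrite_inside[OF i(3), of "k - i" \<beta>] rewrite_inside[OF i(3), of "k - i + 1" \<beta>]
      by (auto simp: algebra_simps)
    then show ?thesis using D_edge[of "k - i" "\<beta> i"] i by simp
  next
    case False
    then have "rewrite_blocks x \<beta> k = x k" by (intro rewrite_outside) blast
    moreover have "rewrite_blocks x \<beta> (k + 1) = x (k + 1)"
      by (rule rewrite_boundary) (use False in force)
    ultimately show ?thesis using assms by (simp add: walks_def)
  qed
qed

text \<open>An occurrence in the new walk that is not at an old block position cannot overlap the
  rewritten blocks, which are occurrences too. So its vertices are unchanged, and it was an
  occurrence before.\<close>

lemma occ_rewrite: "occ b (rewrite_blocks x \<beta>) i \<longleftrightarrow> blk x i \<and> b = \<beta> i"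
proof
  have blk_occ: "occ (\<beta> j) (rewrite_blocks x \<beta>) j" if "blk x j" for j
    using rewrite_inside[OF that] by (simp add: occ_def)
  show "occ b (rewrite_blocks x \<beta>) i" if "blk x i \<and> b = \<beta> i" using that blk_occ by simp
  assume occ: "occ b (rewrite_blocks x \<beta>) i"
  have "blk x i"
  proof (rule ccontr)
    assume nb: "\<not> blk x i"
    have "rewrite_blocks x \<beta> (i + t) = x (i + t)" if "0 \<le> t" "t \<le> l" for t
    proof (rule rewrite_boundary)
      fix j assume j: "j < i + t" "i + t < j + l"
      show "\<not> blk x j"
        using occ_overlap[OF occ blk_occ, of j] j that nb by auto
    qed
    then have "occ b x i" using occ by (simp add: occ_def)
    then show False using nb by (auto simp: blk_def)
  qed
  then show "blk x i \<and> b = \<beta> i" using occ_overlap[OF occ blk_occ] l_pos by auto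
qed

lemma blk_rewrite: "blk (rewrite_blocks x \<beta>) i \<longleftrightarrow> blk x i"
  by (auto simp: blk_def occ_rewrite)

lemma rewrite_eqI:
  assumes "\<And>i. blk x i \<longleftrightarrow> blk y i" "\<And>i. blk x i \<Longrightarrow> \<beta> i = \<gamma> i"
    and "\<And>k. (\<And>i. i \<le> k \<Longrightarrow> k < i + l \<Longrightarrow> \<not> blk x i) \<Longrightarrow> x k = y k"
  shows "rewrite_blocks x \<beta> = rewrite_blocks y \<gamma>"
proof
  fix k
  show "rewrite_blocks x \<beta> k = rewrite_blocks y \<gamma> k"
  proof (cases "\<exists>i. i \<le> k \<and> k < i + l \<and> blk x i")
    case True
    then obtain i where i: "i \<le> k" "k < i + l" "blk x i" by blast
    then show ?thesis
      using rewrite_inside'[of x i "k - i" \<beta>] rewrite_inside'[of y i "k - i" \<gamma>] assms(1,2) by simp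
  next
    case False
    then show ?thesis using assms by (metis rewrite_outside)
  qed
qed

lemma rewrite_rewrite: "rewrite_blocks (rewrite_blocks x \<beta>) \<gamma> = rewrite_blocks x \<gamma>"
  by (rule rewrite_eqI) (auto simp: blk_rewrite rewrite_outside)

lemma rewrite_bits: "rewrite_blocks x (\<lambda>i. occ True x i) = x"
proof
  fix k
  show "rewrite_blocks x (\<lambda>i. occ True x i) k = x k"
  proof (cases "\<exists>i. i \<le> k \<and> k < i + l \<and> blk x i")
    case True
    then obtain i where i: "i \<le> k" "k < i + l" "blk x i" by blast
    then obtain b where b: "occ b x i" by (auto simp: blk_def)
    then have "b = occ True x i" using occ_overlap[of b x i True i] l_pos by auto
    then have "rewrite_blocks x (\<lambda>i. occ True x i) k = D b (k - i)"
      using rewrite_inside'[OF i(3), of "k - i" "\<lambda>i. occ True x i"] i by simp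
    moreover have "x (i + (k - i)) = D b (k - i)" 
      by (rule b[unfolded occ_def, rule_format]) (use i in auto)
    ultimately show ?thesis by simp
  next
    case False
    then show ?thesis by (intro rewrite_outside) blast
  qed
qed

text \<open>On a run of abutting blocks this is the additive cellular automaton on bits. A block
  with no successor at distance \<open>l\<close> keeps its bit, because
  \<open>occ True x (i + l)\<close> is then false.\<close>

definition xor_map :: "(int \<Rightarrow> 'v) \<Rightarrow> int \<Rightarrow> 'v" where
  "xor_map x = rewrite_blocks x (\<lambda>i. occ True x i \<noteq> occ True x (i + l))"

text \<open>Since block positions are preserved, finding a preimage of \<open>y\<close> means
  solving the gated equation for the bits \<open>c\<close>.\<close>

lemma xor_map_rewrite:
  assumes "\<And>i. blk y i \<Longrightarrow> occ True y i = (c i \<noteq> (blk y (i + l) \<and> c (i + l)))"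
  shows "xor_map (rewrite_blocks y c) = y"
proof -
  have "xor_map (rewrite_blocks y c) = rewrite_blocks y (\<lambda>i. occ True y i)"
    unfolding xor_map_def rewrite_rewrite
    by (rule rewrite_eqI) (auto simp: occ_rewrite assms)
  then show ?thesis by (simp add: rewrite_bits)
qed

lemma occ_shift: "occ b (shift x) i \<longleftrightarrow> occ b x (i + 1)"
  by (simp add: occ_def shift_by_def algebra_simps)

lemma blk_shift: "blk (shift x) i \<longleftrightarrow> blk x (i + 1)"
  unfolding blk_def occ_shift ..

lemma xor_map_shift: "xor_map (shift x) = shift (xor_map x)"
proof
  fix k
  show "xor_map (shift x) k = shift (xor_map x) k"
  proof (cases "\<exists>i. i \<le> k + 1 \<and> k + 1 < i + l \<and> blk x i")
    case True
    then obtain i where i: "i \<le> k + 1" "k + 1 < i + l" "blk x i" by blast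
    have b: "blk (shift x) (i - 1)" using i unfolding blk_shift by simp
    have "xor_map (shift x) (i - 1 + (k - (i - 1))) = D (occ True x i \<noteq> occ True x (i + l)) (k - (i - 1))"
      unfolding xor_map_def using rewrite_inside'[OF b, of "k - (i - 1)"] i unfolding occ_shift
      by (simp add: algebra_simps)
    moreover have "xor_map x (i + (k + 1 - i)) = D (occ True x i \<noteq> occ True x (i + l)) (k + 1 - i)"
      unfolding xor_map_def using rewrite_inside'[OF i(3), of "k + 1 - i"] i by simp
    ultimately show ?thesis by (simp add: shift_by_def algebra_simps)
  next
    case False
    have "xor_map (shift x) k = shift x k"
      unfolding xor_map_def by (rule rewrite_outside) (use False blk_shift in force)
    moreover have "xor_map x (k + 1) = x (k + 1)"
      unfolding xor_map_def by (rule rewrite_outside) (use False in force)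
    ultimately show ?thesis by (simp add: shift_by_def)
  qed
qed

text \<open>A block covering \<open>i\<close> starts less than \<open>l\<close> before
  \<open>i\<close>, and an abutting successor ends at most \<open>2 * l\<close> after
  \<open>i\<close>; radius \<open>3 * l\<close> covers both.\<close>

lemma xor_map_local:
  assumes "\<And>k. \<bar>k - i\<bar> \<le> 3 * l \<Longrightarrow> x k = y k"
  shows "xor_map x i = xor_map y i"
proof -
  have occ: "occ b x j \<longleftrightarrow> occ b y j" if "\<bar>j - i\<bar> \<le> 2 * l" for b j
  proof -
    have "x (j + t) = y (j + t)" if "0 \<le> t" "t \<le> l" for t
      using that \<open>\<bar>j - i\<bar> \<le> 2 * l\<close> by (intro assms) linarith
    then show ?thesis by (auto simp: occ_def)
  qed
  show ?thesis
  proof (cases "\<exists>j. j \<le> i \<and> i < j + l \<and> blk x j")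
    case True
    then obtain j where j: "j \<le> i" "i < j + l" "blk x j" by blast
    have eq: "occ b x j \<longleftrightarrow> occ b y j" "occ b x (j + l) \<longleftrightarrow> occ b y (j + l)" for b
      using j by (intro occ; linarith)+
    then have "blk y j" using j by (simp add: blk_def)
    then show ?thesis
      using j eq rewrite_inside'[OF j(3), of "i - j"] rewrite_inside'[of y j "i - j"]
      by (simp add: xor_map_def)
  next
    case False
    have "\<not> blk y j" if "j \<le> i" "i < j + l" for j
      using False that occ[of j] l_pos by (auto simp: blk_def)
    then have "xor_map y i = y i" by (simp add: xor_map_def rewrite_outside)
    moreover have "xor_map x i = x i" unfolding xor_map_def by (rule rewrite_outside) (use False in blast)
    ultimately show ?thesis using assms[of i] l_pos by simp
  qed
qed

lemma collapsible: "collapsible (walks E)"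
proof -
  have maps: "xor_map ` walks E \<subseteq> walks E" using rewrite_walks by (auto simp: xor_map_def)
  have "y \<in> xor_map ` walks E" if y: "y \<in> walks E" for y
  proof -
    obtain c where c: "\<And>i. c i = (occ True y i \<noteq> (blk y (i + l) \<and> c (i + l)))"
      using gated_xor_antiderivative[OF l_pos, of "occ True y" "blk y"] by blast
    have "xor_map (rewrite_blocks y c) = y" by (rule xor_map_rewrite) (use c in metis)
    then show ?thesis using rewrite_walks[OF y, of c] by (metis image_eqI)
  qed
  with maps have surj: "xor_map ` walks E = walks E" by blast
  \<comment> \<open>In this periodic walk every block has a successor, so the constant bit sequences
    \<open>True\<close> and \<open>False\<close> both map to constant \<open>False\<close>.\<close>
  define y where "y k = D False (k mod l)" for k
  have y: "y \<in> walks E"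
    unfolding walks_def
  proof (intro CollectI allI)
    fix k
    have "y (k + 1) = D False (k mod l + 1)"
    proof (cases "k mod l + 1 = l")
      case True
      then have "(k + 1) mod l = 0" by (metis mod_add_left_eq mod_self)
      then show ?thesis using True D_start D_end by (simp add: y_def)
    next
      case False
      then have "(k + 1) mod l = k mod l + 1"
        using l_pos by (smt (verit) mod_add_left_eq mod_pos_pos_trivial pos_mod_bound pos_mod_sign)
      then show ?thesis by (simp add: y_def)
    qed
    then show "(y k, y (k + 1)) \<in> E" using D_edge[of "k mod l"] l_pos by (simp add: y_def)
  qed
  have y_mult: "occ False y (m * l)" for m
  proof -
    have "y (m * l + t) = D False t" if "0 \<le> t" "t \<le> l" for t
      using that D_start D_end by (cases "t = l") (auto simp: y_def)
    then show ?thesis by (simp add: occ_def)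
  qed
  have blk_y: "\<not> occ True y i \<and> blk y (i + l)" if blk: "blk y i" for i
  proof -
    have le: "i div l * l \<le> i" "i < i div l * l + l"
      using l_pos by (auto simp: div_mult_mod_eq[symmetric] algebra_simps minus_mod_eq_mult_div [symmetric])
    obtain b where b: "occ b y i" using blk by (auto simp: blk_def)
    \<comment> \<open>Any occurrence starting at \<open>i\<close> overlaps the standard block
      starting at the multiple of \<open>l\<close> below \<open>i\<close>, hence is that
      block.\<close>
    have i: "i = i div l * l \<and> b = False" using occ_overlap[OF b y_mult[of "i div l"]] le l_pos by auto
    have "occ False y ((i div l + 1) * l)" by (rule y_mult)
    also have "(i div l + 1) * l = i + l" using i by (simp add: algebra_simps)
    finally have "blk y (i + l)" by (auto simp: blk_def)
    moreover have "\<not> occ True y i" using occ_overlap[of True y i b i] b i l_pos by auto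
    ultimately show ?thesis by blast
  qed
  have eq: "xor_map (rewrite_blocks y (\<lambda>_. c)) = y" for c
    by (rule xor_map_rewrite) (use blk_y in auto)
  have "blk y 0" using y_mult[of 0] by (auto simp: blk_def)
  then have "occ True (rewrite_blocks y (\<lambda>_. True)) 0" "\<not> occ True (rewrite_blocks y (\<lambda>_. False)) 0"
    by (auto simp: occ_rewrite)
  then have "rewrite_blocks y (\<lambda>_. True) \<noteq> rewrite_blocks y (\<lambda>_. False)" by metis
  then have "\<not> inj_on xor_map (walks E)"
    using eq[of True] eq[of False] rewrite_walks[OF y] by (metis inj_onD)
  moreover have "sliding_block_endo (walks E) xor_map"
    unfolding sliding_block_endo_def using maps xor_map_shift xor_map_local by metis
  ultimately show ?thesis using surj by (auto simp: collapsible_def)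
qed

end

section \<open>Two loops at a vertex\<close>

text \<open>In \<open>branch\<close>, appending \<open>v\<close> covers the case that one of the
  loops is a single edge from \<open>v\<close> to itself.\<close>

locale loop_pair =
  fixes E :: "('v \<times> 'v) set" and v :: 'v and p q :: "'v list"
  assumes edges: "successively (\<lambda>a b. (a, b) \<in> E) (v # p @ [v])"
      "successively (\<lambda>a b. (a, b) \<in> E) (v # q @ [v])"
    and first_return: "v \<notin> set p" "v \<notin> set q"
    and branch: "hd (p @ [v]) \<noteq> hd (q @ [v])"
begin

definition loop :: "bool \<Rightarrow> 'v list" where
  "loop b = v # (if b then p else q)"

definition word :: "bool list \<Rightarrow> 'v list" where
  "word bs = concat (map loop bs) @ [v]"

lemma word_simps [simp]: "word [] = [v]" "word (b # bs) = loop b @ word bs"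
  by (auto simp: word_def)

lemma word_nth_0 [simp]: "word bs ! 0 = v" and word_hd [simp]: "hd (word bs) = v"
  and word_ne [simp]: "word bs \<noteq> []"
  by (cases bs; simp add: loop_def)+

lemma successively_word: "successively (\<lambda>a b. (a, b) \<in> E) (word bs)"
proof (induction bs)
  case (Cons b bs)
  have "successively (\<lambda>a b. (a, b) \<in> E) (loop b @ [v])" using edges by (auto simp: loop_def)
  then show ?case using Cons by (auto simp: successively_append_iff)
qed simp

text \<open>Loops do not meet \<open>v\<close> in between, so \<open>v\<close> marks exactly the
  boundaries between loops. The last conjunct identifies the empty remainder as the final
  \<open>v\<close>.\<close>

lemma drop_word:
  assumes "s < length (word bs)" "word bs ! s = v"
  shows "\<exists>k \<le> length bs. drop s (word bs) = word (drop k bs) \<and> (s = 0 \<longleftrightarrow> k = 0)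
    \<and> (k = length bs \<longrightarrow> s = length (word bs) - 1)"
  using assms
proof (induction bs arbitrary: s)
  case (Cons b bs)
  show ?case
  proof (cases "s < length (loop b)")
    case True
    then have "s = 0"
      using Cons.prems(2) first_return by (auto simp: nth_append loop_def nth_Cons split: nat.splits if_splits)
    then show ?thesis by (intro exI[of _ 0]) auto
  next
    case False
    then have "s - length (loop b) < length (word bs)" "word bs ! (s - length (loop b)) = v"
      using Cons.prems by (auto simp: nth_append)
    then obtain k where k: "k \<le> length bs" "drop (s - length (loop b)) (word bs) = word (drop k bs)"
       "k = length bs \<longrightarrow> s - length (loop b) = length (word bs) - 1"
      using Cons.IH by blast
    moreover obtain m where "length (word bs) = Suc m" by (cases "word bs") auto
    moreover have "s \<noteq> 0" using False by (auto simp: loop_def)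
    ultimately show ?thesis using False
      by (intro exI[of _ "Suc k"]) auto
  qed
qed auto

text \<open>Unique decoding from the left: by \<open>branch\<close>, the vertex following a
  \<open>v\<close> tells which loop begins there.\<close>

lemma prefix_word: "prefix (word us) (word ws) \<Longrightarrow> prefix us ws"
proof (induction us arbitrary: ws)
  case (Cons u us)
  show ?case
  proof (cases ws)
    case Nil
    then have "length (word (u # us)) \<le> 1" using Cons.prems prefix_length_le by fastforce
    moreover have "length (word us) > 0" by simp
    ultimately show ?thesis by (simp add: loop_def)
  next
    case (Cons w ws')
    have nth1: "word (b # bs) ! 1 = hd ((if b then p else q) @ [v])" for b bs
      by (cases "if b then p else q") (auto simp: loop_def nth_append)
    have len: "1 < length (word (u # us))" using word_ne[of us] by (auto simp: loop_def)
    have "word (u # us) ! 1 = word (w # ws') ! 1"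
      using Cons.prems Cons len unfolding prefix_def by (metis nth_append)
    then have uw: "u = w" unfolding nth1 using branch by (auto split: if_splits)
    then have "prefix (word us) (word ws')" using Cons.prems Cons by simp
    then show ?thesis using Cons.IH uw Cons by simp
  qed
qed simp

text \<open>The two code words start with the only occurrence of three consecutive \<open>True\<close> and end with
  \<open>False\<close>, so no proper suffix of one is a prefix of the other. They use each loop equally often.\<close>

definition code :: "bool \<Rightarrow> bool list" where
  "code b = [True, True, True, False, b, \<not> b, False]"

lemma code_unbordered: "prefix (drop k (code b)) (code c) \<Longrightarrow> k < 7 \<Longrightarrow> k = 0 \<and> b = c"
  by (cases b; cases c; simp add: code_def less_Suc_eq numeral_eq_Suc; elim disjE; simp)

lemma length_word_code: "length (word (code b)) = length (word (code c))"
  by (cases b; cases c) (simp_all add: code_def loop_def)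

text \<open>If a second occurrence starts inside a first one, it starts at a \<open>v\<close>, hence
  at a loop boundary. The rest of the first word then decodes to a suffix of its code that is a
  prefix of the other code.\<close>

lemma block_pair:
  "block_pair E (\<lambda>b t. word (code b) ! nat t) (int (length (word (code True)) - 1)) v"
proof
  let ?n = "length (word (code True)) - 1"
  have len: "length (word (code b)) = Suc ?n" for b
    using length_word_code[of b True] word_ne[of "code True"] by (cases "word (code True)") auto
  show "0 < int ?n" by (simp add: code_def loop_def)
  show "(word (code b) ! nat t, word (code b) ! nat (t + 1)) \<in> E" if "0 \<le> t" "t < int ?n" for b t
    using successively_word[of "code b"] that len[of b]
    by (auto simp: successively_conv_nth nat_add_distrib)
  show "word (code b) ! nat 0 = v" for b by simp
  show "word (code b) ! nat (int ?n) = v" for b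
    using len[of b] by (simp add: word_def nth_append)
  fix x :: "int \<Rightarrow> 'v" and b c i j
  assume i: "\<And>t. 0 \<le> t \<Longrightarrow> t \<le> int ?n \<Longrightarrow> x (i + t) = word (code b) ! nat t"
    and j: "\<And>t. 0 \<le> t \<Longrightarrow> t \<le> int ?n \<Longrightarrow> x (j + t) = word (code c) ! nat t"
    and ij: "i \<le> j" "j < i + int ?n"
  define s where "s = nat (j - i)"
  have s: "j = i + int s" "s < ?n" using ij by (auto simp: s_def)
  have "word (code b) ! s = v" using i[of "int s"] j[of 0] s by simp
  moreover have "s < length (word (code b))" "length (word (code b)) - 1 = ?n" using s(2) len[of b] by auto
  ultimately obtain k where k: "k \<le> length (code b)" "drop s (word (code b)) = word (drop k (code b))"
      "s = 0 \<longleftrightarrow> k = 0" "k = length (code b) \<longrightarrow> s = ?n"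
    using drop_word[of s "code b"] by metis
  have "drop s (word (code b)) = take (Suc ?n - s) (word (code c))"
  proof (rule nth_equalityI)
    fix t assume "t < length (drop s (word (code b)))"
    then have t: "s + t \<le> ?n" using len[of b] by simp
    have "x (i + int (s + t)) = word (code b) ! (s + t)" using i[of "int (s + t)"] t unfolding nat_int by simp
    moreover have "x (j + int t) = word (code c) ! t" using j[of "int t"] t by simp
    ultimately show "drop s (word (code b)) ! t = take (Suc ?n - s) (word (code c)) ! t"
      using t len[of b] len[of c] s by (simp add: algebra_simps)
  qed (use len[of b] len[of c] in auto)
  then have "prefix (word (drop k (code b))) (word (code c))" using k(2) by (metis take_is_prefix)
  then have "prefix (drop k (code b)) (code c)" by (rule prefix_word)
  \<comment> \<open>The value 7 would mean that only the end vertex is shared, that is, that the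
    occurrences abut.\<close>
  moreover have "k < 7" using k(1,4) s(2) by (auto simp: code_def)
  ultimately have "k = 0 \<and> b = c" by (rule code_unbordered)
  then show "i = j \<and> b = c" using k(3) s by simp
qed

end

text \<open>The path is built backwards from its end and discarded whenever \<open>v\<close> is met
  again.\<close>

lemma first_return_path:
  assumes "(a, v) \<in> E\<^sup>*"
  shows "\<exists>p. successively (\<lambda>a b. (a, b) \<in> E) (p @ [v]) \<and> v \<notin> set p \<and> hd (p @ [v]) = a"
  using assms
proof (induction rule: converse_rtrancl_induct)
  case base
  show ?case by (intro exI[of _ "[]"]) simp
next
  case (step a b)
  then obtain p where p: "successively (\<lambda>a b. (a, b) \<in> E) (p @ [v])" "v \<notin> set p" "hd (p @ [v]) = b"
    by blast
  show ?case
  proof (cases "a = v")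
    case True
    then show ?thesis by (intro exI[of _ "[]"]) simp
  next
    case False
    have "successively (\<lambda>a b. (a, b) \<in> E) (a # p @ [v])"
      using p step.hyps by (cases p) auto
    then show ?thesis using False p by (intro exI[of _ "a # p"]) auto
  qed
qed

lemma collapsible_if_branching:
  assumes "(v, a) \<in> E" "(v, b) \<in> E" "a \<noteq> b" "(a, v) \<in> E\<^sup>*" "(b, v) \<in> E\<^sup>*"
  shows "collapsible (walks E)"
proof -
  obtain p where p: "successively (\<lambda>a b. (a, b) \<in> E) (p @ [v])" "v \<notin> set p" "hd (p @ [v]) = a"
    using first_return_path[OF assms(4)] by blast
  obtain q where q: "successively (\<lambda>a b. (a, b) \<in> E) (q @ [v])" "v \<notin> set q" "hd (q @ [v]) = b"
    using first_return_path[OF assms(5)] by blast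
  have "loop_pair E v p q"
    using p q assms by unfold_locales (cases p; cases q; auto)+
  then show ?thesis using loop_pair.block_pair block_pair.collapsible by metis
qed

section \<open>Advancing the entry into a sink cycle\<close>

lemma walks_edge: "x \<in> walks E \<Longrightarrow> (x i, x (i + 1)) \<in> E"
  by (simp add: walks_def)

lemma shift_by_walks: "x \<in> walks E \<Longrightarrow> shift_by n x \<in> walks E"
proof -
  assume "x \<in> walks E"
  then have "(x (i + n), x (i + n + 1)) \<in> E" for i by (simp add: walks_def)
  then show ?thesis by (simp add: walks_def shift_by_def algebra_simps)
qed

lemma splice_walks:
  assumes "x \<in> walks E" "y \<in> walks E" "x n = y n"
  shows "(\<lambda>i. if i \<ge> n then y i else x i) \<in> walks E"
  unfolding walks_def
proof (intro CollectI allI)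
  fix i
  show "(if i \<ge> n then y i else x i, if i + 1 \<ge> n then y (i + 1) else x (i + 1)) \<in> E"
    using walks_edge[OF assms(1), of i] walks_edge[OF assms(2), of i] assms(3)
    by (cases "i + 1 = n") auto
qed

text \<open>\<open>P\<close> is a period of \<open>x0\<close> both before the transition and inside
  \<open>C\<close>, so moving the entry by \<open>P\<close> preserves the phase on both
  sides.\<close>

locale sink_entry =
  fixes E :: "('v \<times> 'v) set" and C :: "'v set" and x0 z :: "int \<Rightarrow> 'v" and P T :: int
  assumes sink: "\<And>a b. a \<in> C \<Longrightarrow> (a, b) \<in> E \<Longrightarrow> b \<in> C"
    and det: "\<And>a b c. a \<in> C \<Longrightarrow> (a, b) \<in> E \<Longrightarrow> (a, c) \<in> E \<Longrightarrow> b = c"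
    and x0: "x0 \<in> walks E" and x0_C: "\<And>i. x0 i \<in> C \<longleftrightarrow> i \<ge> 0"
    and P_pos: "P > 0" and T_nonneg: "T \<ge> 0"
    and left_periodic: "\<And>i. i \<le> - T \<Longrightarrow> x0 (i - P) = x0 i"
    and right_periodic: "\<And>i. i \<ge> 0 \<Longrightarrow> x0 (i + P) = x0 i"
    and z: "z \<in> walks E" and z_eq: "\<And>i. i \<ge> - T - P \<Longrightarrow> z i = x0 i"
    and z_neq: "\<exists>i. - T - 2 * P \<le> i \<and> i < - T - P \<and> z i \<noteq> x0 i"
begin

text \<open>\<open>hit m x j\<close>: the walk \<open>x\<close> enters \<open>C\<close> at time \<open>j\<close> in the same way as \<open>x0\<close> does at time \<open>0\<close>, after
  at least \<open>m\<close> periods \<open>P\<close> of the cycle preceding the transition. The walk \<open>z\<close> has one such period but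
  not two, so it is fixed by the map below and also arises from a walk with one more period.\<close>

definition hit :: "int \<Rightarrow> (int \<Rightarrow> 'v) \<Rightarrow> int \<Rightarrow> bool" where
  "hit m x j \<longleftrightarrow> (\<forall>i. - T - m * P \<le> i \<longrightarrow> i \<le> 0 \<longrightarrow> x (j + i) = x0 i)"

text \<open>\<open>hit\<close> prescribes the walk only up to the entry; afterwards
  \<open>det\<close> leaves it no choice.\<close>

lemma hit_eq:
  assumes "x \<in> walks E" "hit m x j" "m \<ge> 1" "- T - m * P \<le> i"
  shows "x (j + i) = x0 i"
proof -
  have mP: "m * P > 0" using assms(3) P_pos by simp
  have "x (j + int n) = x0 (int n)" for n
  proof (induction n)
    case 0
    have "x (j + 0) = x0 0" by (rule assms(2)[unfolded hit_def, rule_format]) (use mP T_nonneg in auto)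
    then show ?case by simp
  next
    case (Suc n)
    show ?case
    proof (rule det[of "x0 (int n)"])
      show "x0 (int n) \<in> C" by (simp add: x0_C)
      show "(x0 (int n), x (j + int (Suc n))) \<in> E"
        using walks_edge[OF assms(1), of "j + int n"] Suc by (simp add: algebra_simps)
      show "(x0 (int n), x0 (int (Suc n))) \<in> E"
        using walks_edge[OF x0, of "int n"] by (simp add: algebra_simps)
    qed
  qed
  then have "x (j + i) = x0 i" if "i \<ge> 0" using that by (metis int_nat_eq)
  moreover have "x (j + i) = x0 i" if "i \<le> 0" using that assms(2,4) by (simp add: hit_def)
  ultimately show ?thesis by linarith
qed

lemma sink_forward:
  assumes "x \<in> walks E" "x k \<in> C" "k \<le> j"
  shows "x j \<in> C"
  using assms(3)
proof (induction j rule: int_ge_induct)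
  case base
  then show ?case using assms by simp
next
  case (step j)
  then show ?case using sink walks_edge[OF assms(1)] by blast
qed

text \<open>\<open>C\<close> cannot be left, so the times spent in it form a half-line, and a hit is
  its first point. In particular a walk has at most one hit.\<close>

lemma hit_C:
  assumes "x \<in> walks E" "hit m x j" "m \<ge> 1"
  shows "x k \<in> C \<longleftrightarrow> k \<ge> j"
proof
  have mP: "m * P > 0" using assms(3) P_pos by simp
  show "x k \<in> C" if "k \<ge> j"
    using hit_eq[OF assms, of "k - j"] that mP T_nonneg x0_C[of "k - j"] by simp
  assume C: "x k \<in> C"
  show "k \<ge> j"
  proof (rule ccontr)
    assume "\<not> k \<ge> j"
    then have "x (j - 1) \<in> C" using sink_forward[OF assms(1) C] by simp
    moreover have "x (j + - 1) = x0 (- 1)" using mP T_nonneg by (intro hit_eq[OF assms]) linarith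
    ultimately show False using x0_C[of "- 1"] by simp
  qed
qed

lemma hit_unique:
  assumes "x \<in> walks E" "hit m x j" "m \<ge> 1" "hit n x k" "n \<ge> 1"
  shows "j = k"
  using hit_C[OF assms(1-3)] hit_C[OF assms(1,4,5)] by (metis order.antisym order_refl)

text \<open>Before the entry at \<open>j\<close>, a stretch of length \<open>T + 2 * P\<close> is
  replaced by a copy of \<open>x0\<close> entering at \<open>j - P\<close>. The copy fits on the
  left by \<open>left_periodic\<close> and agrees with the walk from \<open>j\<close> on by
  \<open>right_periodic\<close>; hence only nearby \<open>j\<close> matter and the rule is
  local.\<close>

definition advance_entry :: "(int \<Rightarrow> 'v) \<Rightarrow> int \<Rightarrow> 'v" where
  "advance_entry x k = (if \<exists>j. k < j \<and> j \<le> k + T + 2 * P \<and> hit 2 x j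
     then x0 (k - (THE j. hit 2 x j) + P) else x k)"

lemma advance_entry_near:
  assumes "x \<in> walks E" "hit 2 x j" "k < j" "j \<le> k + T + 2 * P"
  shows "advance_entry x k = x0 (k - j + P)"
proof -
  have "(THE j. hit 2 x j) = j"
    by (rule the_equality) (use assms hit_unique[of x 2 _ 2] in auto)
  then show ?thesis using assms by (auto simp: advance_entry_def)
qed

lemma advance_entry_far:
  assumes "\<And>j. k < j \<Longrightarrow> j \<le> k + T + 2 * P \<Longrightarrow> \<not> hit 2 x j"
  shows "advance_entry x k = x k"
  using assms by (auto simp: advance_entry_def)

lemma advance_entry_hit:
  assumes "x \<in> walks E" "hit 2 x j"
  shows "advance_entry x = (\<lambda>k. if k \<ge> j - T - 2 * P then x0 (k - j + P) else x k)"
proof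
  fix k
  consider "k < j - T - 2 * P" | "j - T - 2 * P \<le> k" "k < j" | "k \<ge> j" by linarith
  then show "advance_entry x k = (if k \<ge> j - T - 2 * P then x0 (k - j + P) else x k)"
  proof cases
    case 1
    then have "advance_entry x k = x k"
      using hit_unique[OF assms] by (intro advance_entry_far) force
    then show ?thesis using 1 by simp
  next
    case 2
    then show ?thesis using advance_entry_near[OF assms, of k] by simp
  next
    case 3
    have "advance_entry x k = x k"
      using hit_unique[OF assms] 3 by (intro advance_entry_far) force
    also have "x (j + (k - j)) = x0 (k - j)"
      using 3 T_nonneg P_pos by (intro hit_eq[OF assms]) auto
    then have "x k = x0 (k - j + P)" using right_periodic[of "k - j"] 3 by simp
    finally show ?thesis using 3 T_nonneg P_pos by simp
  qed
qed

lemma advance_entry_walks: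
  assumes "x \<in> walks E"
  shows "advance_entry x \<in> walks E"
proof (cases "\<exists>j. hit 2 x j")
  case True
  then obtain j where j: "hit 2 x j" by blast
  have "x (j + (- T - 2 * P)) = x0 (- T - 2 * P)" by (rule hit_eq[OF assms j]) auto
  also have "\<dots> = x0 (- T - P)" using left_periodic[of "- T - P"] P_pos by (simp add: algebra_simps)
  also have "- T - P = j - T - 2 * P + (P - j)" by simp
  finally have "x (j + (- T - 2 * P)) = x0 (j - T - 2 * P + (P - j))" .
  moreover have "j + (- T - 2 * P) = j - T - 2 * P" by simp
  ultimately have "x (j - T - 2 * P) = shift_by (P - j) x0 (j - T - 2 * P)"
    by (simp only: shift_by_def)
  from splice_walks[OF assms shift_by_walks[OF x0] this]
  have "(\<lambda>i. if i \<ge> j - T - 2 * P then x0 (i + (P - j)) else x i) \<in> walks E"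
    unfolding shift_by_def .
  moreover have "i + (P - j) = i - j + P" for i by simp
  ultimately show ?thesis unfolding advance_entry_hit[OF assms j] by (simp only:)
next
  case False
  then have "advance_entry x = x" by (intro ext advance_entry_far) blast
  then show ?thesis using assms by simp
qed

text \<open>Inserting one more period postpones the entry by \<open>P\<close> and turns one
  available period into two.\<close>

lemma advance_entry_preimage:
  assumes "y \<in> walks E" "hit 1 y j"
  obtains x where "x \<in> walks E" "hit 2 x (j + P)" "advance_entry x = y"
proof -
  define x where "x = (\<lambda>k. if k \<ge> j - T - P then shift_by (- j - P) x0 k else y k)"
  have y_eq: "y k = x0 (k - j)" if "k \<ge> j - T - P" for k
    using hit_eq[OF assms, of "k - j"] that by simp
  have "x0 (- T - P - P) = x0 (- T - P)" using left_periodic[of "- T - P"] P_pos by simp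
  moreover have "j - T - P + (- j - P) = - T - P - P" "j - T - P - j = - T - P" by auto
  ultimately have "y (j - T - P) = shift_by (- j - P) x0 (j - T - P)"
    using y_eq[of "j - T - P"] by (simp only: shift_by_def order_refl)
  then have x: "x \<in> walks E" unfolding x_def by (rule splice_walks[OF assms(1) shift_by_walks[OF x0]])
  moreover have hit: "hit 2 x (j + P)" by (auto simp: hit_def x_def shift_by_def)
  moreover have "advance_entry x = y"
  proof
    fix k
    show "advance_entry x k = y k"
      unfolding advance_entry_hit[OF x hit] using y_eq[of k] by (auto simp: x_def)
  qed
  ultimately show ?thesis using that by blast
qed

lemma hit_mono: "hit 2 x j \<Longrightarrow> hit 1 x j"
  using P_pos by (auto simp: hit_def)

lemma hit_shift: "hit m (shift x) j \<longleftrightarrow> hit m x (j + 1)"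
  by (simp add: hit_def shift_by_def algebra_simps)

lemma advance_entry_shift:
  assumes x: "x \<in> walks E"
  shows "advance_entry (shift x) = shift (advance_entry x)"
proof
  fix k
  have sx: "shift x \<in> walks E" using shift_by_walks[OF x] by simp
  show "advance_entry (shift x) k = shift (advance_entry x) k"
  proof (cases "\<exists>j. k + 1 < j \<and> j \<le> k + 1 + T + 2 * P \<and> hit 2 x j")
    case True
    then obtain j where j: "k + 1 < j" "j \<le> k + 1 + T + 2 * P" "hit 2 x j" by blast
    have "hit 2 (shift x) (j - 1)" using j(3) unfolding hit_shift by simp
    from advance_entry_near[OF sx this, of k] advance_entry_near[OF x j(3), of "k + 1"]
    show ?thesis using j by (simp add: shift_by_def algebra_simps)
  next
    case False
    have "advance_entry x (k + 1) = x (k + 1)"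
      by (rule advance_entry_far) (use False in blast)
    moreover have "advance_entry (shift x) k = shift x k"
      by (rule advance_entry_far) (unfold hit_shift, use False in force)
    ultimately show ?thesis by (simp add: shift_by_def)
  qed
qed

lemma advance_entry_local:
  assumes "x \<in> walks E" "y \<in> walks E" and eq: "\<And>k. \<bar>k - i\<bar> \<le> T + 2 * P \<Longrightarrow> x k = y k"
  shows "advance_entry x i = advance_entry y i"
proof -
  have hit: "hit 2 x j \<longleftrightarrow> hit 2 y j" if j: "i < j" "j \<le> i + T + 2 * P" for j
  proof -
    have "x (j + k) = y (j + k)" if "- T - 2 * P \<le> k" "k \<le> 0" for k
      using that j by (intro eq) linarith
    then show ?thesis by (auto simp: hit_def)
  qed
  show ?thesis
  proof (cases "\<exists>j. i < j \<and> j \<le> i + T + 2 * P \<and> hit 2 x j")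
    case True
    then obtain j where j: "i < j" "j \<le> i + T + 2 * P" "hit 2 x j" by blast
    then show ?thesis using hit advance_entry_near assms by metis
  next
    case False
    have "advance_entry x i = x i" by (rule advance_entry_far) (use False in blast)
    moreover have "advance_entry y i = y i" by (rule advance_entry_far) (use False hit in blast)
    ultimately show ?thesis using eq[of i] P_pos T_nonneg by simp
  qed
qed

lemma collapsible: "collapsible (walks E)"
proof -
  have "y \<in> advance_entry ` walks E" if y: "y \<in> walks E" for y
  proof (cases "\<exists>j. hit 1 y j")
    case True
    then show ?thesis using advance_entry_preimage[OF y] by (metis image_eqI)
  next
    case False
    then have "advance_entry y = y" using hit_mono by (intro ext advance_entry_far) blast
    then show ?thesis using y by (metis image_eqI)
  qed
  then have surj: "advance_entry ` walks E = walks E" using advance_entry_walks by blast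
  have z1: "hit 1 z 0" using z_eq by (simp add: hit_def)
  have z2: "\<not> hit 2 z j" for j
  proof
    assume h: "hit 2 z j"
    then have "j = 0" using hit_unique[OF z h _ z1] by simp
    moreover obtain i where "- T - 2 * P \<le> i" "i < - T - P" "z i \<noteq> x0 i" using z_neq by blast
    ultimately show False using hit_eq[OF z h, of i] by simp
  qed
  then have "advance_entry z = z" by (intro ext advance_entry_far) blast
  moreover obtain x where "x \<in> walks E" "hit 2 x (0 + P)" "advance_entry x = z"
    using advance_entry_preimage[OF z z1] .
  ultimately have "\<not> inj_on advance_entry (walks E)" using z z2 by (metis inj_onD)
  moreover have "sliding_block_endo (walks E) advance_entry"
    unfolding sliding_block_endo_def using surj advance_entry_shift advance_entry_local
    by (metis order_refl)
  ultimately show ?thesis using surj by (auto simp: collapsible_def)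
qed

end

section \<open>Graphs whose cycles are disjoint\<close>

lemma walks_reach:
  assumes "x \<in> walks E" "i \<le> j"
  shows "(x i, x j) \<in> E\<^sup>*"
  using assms(2)
proof (induction j rule: int_ge_induct)
  case (step j)
  then show ?case using walks_edge[OF assms(1), of j] by auto
qed simp

text \<open>By \<open>unique_return\<close>, every strongly connected component is a single cycle or
  a single vertex without a loop.\<close>

locale deterministic_graph =
  fixes E :: "('v \<times> 'v) set"
  assumes finite_E: "finite E"
    and extend: "\<And>a b. (a, b) \<in> E \<Longrightarrow> \<exists>x\<in>walks E. x 0 = a \<and> x 1 = b"
    and unique_return: "\<And>v a b. (v, a) \<in> E \<Longrightarrow> (v, b) \<in> E \<Longrightarrow> (a, v) \<in> E\<^sup>* \<Longrightarrow> (b, v) \<in> E\<^sup>* \<Longrightarrow> a = b"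
begin

text \<open>A potential that never increases along a walk and is constant along an edge exactly when
  the edge can be returned.\<close>

definition reach :: "'v \<Rightarrow> nat" where
  "reach v = card (E\<^sup>* `` {v})"

lemma finite_reach: "finite (E\<^sup>* `` {v})"
proof (rule finite_subset)
  show "E\<^sup>* `` {v} \<subseteq> insert v (Range E)" by (auto elim: rtranclE)
  show "finite (insert v (Range E))" using finite_E by (simp add: finite_Range)
qed

lemma reach_mono: "(a, b) \<in> E\<^sup>* \<Longrightarrow> reach b \<le> reach a"
  unfolding reach_def by (rule card_mono[OF finite_reach]) auto

lemma reach_back:
  assumes "(a, b) \<in> E\<^sup>*" "reach a \<le> reach b"
  shows "(b, a) \<in> E\<^sup>*"
proof -
  have "E\<^sup>* `` {b} \<subseteq> E\<^sup>* `` {a}" using assms(1) by auto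
  then have "E\<^sup>* `` {b} = E\<^sup>* `` {a}"
    using assms(2) card_seteq[OF finite_reach] by (simp add: reach_def)
  then show ?thesis by auto
qed

text \<open>In the component \<open>K\<close> of \<open>u\<close> the successor map \<open>s\<close>
  reaches every vertex, since each has a predecessor in \<open>K\<close>. As \<open>K\<close> is
  finite, \<open>s\<close> is injective there.\<close>

lemma unique_return_backward:
  assumes "(a, u) \<in> E" "(b, u) \<in> E" "(u, a) \<in> E\<^sup>*" "(u, b) \<in> E\<^sup>*"
  shows "a = b"
proof -
  define K where "K = {c. (u, c) \<in> E\<^sup>* \<and> (c, u) \<in> E\<^sup>*}"
  define s where "s c = (SOME d. (c, d) \<in> E \<and> (d, c) \<in> E\<^sup>*)" for c
  have s: "s c = d" if "(c, d) \<in> E" "(d, c) \<in> E\<^sup>*" for c d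
    unfolding s_def by (rule some_equality) (use that unique_return in auto)
  have fin: "finite K" by (rule finite_subset[OF _ finite_reach[of u]]) (auto simp: K_def)
  have "d \<in> s ` K" if d: "d \<in> K" for d
  proof -
    have "\<exists>c\<in>K. (c, d) \<in> E"
    proof (cases "d = u")
      case True
      then show ?thesis using assms(1,3) by (intro bexI[of _ a]) (auto simp: K_def)
    next
      case False
      moreover have "(u, d) \<in> E\<^sup>*" using d by (simp add: K_def)
      ultimately obtain c where c: "(u, c) \<in> E\<^sup>*" "(c, d) \<in> E" by (auto elim: rtranclE)
      then have "(c, u) \<in> E\<^sup>*" using d by (auto simp: K_def)
      then show ?thesis using c by (auto simp: K_def)
    qed
    then obtain c where c: "c \<in> K" "(c, d) \<in> E" by blast
    have "(d, c) \<in> E\<^sup>*" using c d by (auto simp: K_def)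
    then show ?thesis using s c by blast
  qed
  then have "K \<subseteq> s ` K" by blast
  then have "card (s ` K) = card K"
    using fin card_mono[of "s ` K" K] card_image_le[OF fin, of s] by simp
  then have "inj_on s K" using fin by (simp add: eq_card_imp_inj_on)
  moreover have "a \<in> K" "b \<in> K" using assms by (auto simp: K_def)
  moreover have "s a = u" "s b = u" using s assms by auto
  ultimately show ?thesis by (simp add: inj_on_def)
qed

lemma walks_Field: "x \<in> walks E \<Longrightarrow> x i \<in> Field E"
  using walks_edge[of x E i] by (auto simp: Field_def)

text \<open>Such a walk stays in one cycle, so its vertex at time 0 determines it in both
  directions.\<close>

lemma finite_recurrent_walks: "finite {x \<in> walks E. \<forall>i. (x (i + 1), x i) \<in> E\<^sup>*}" (is "finite ?R")
proof (rule inj_on_finite[of "\<lambda>x. x 0"])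
  show "inj_on (\<lambda>x. x 0) ?R"
  proof (rule inj_onI, rule ext)
    fix x y and i :: int assume x: "x \<in> ?R" and y: "y \<in> ?R" and eq: "x 0 = y 0"
    show "x i = y i"
    proof (induction i rule: int_induct[of _ 0])
      case base
      show ?case by (fact eq)
    next
      case (step1 i)
      have "(x i, x (i + 1)) \<in> E" "(x i, y (i + 1)) \<in> E" "(x (i + 1), x i) \<in> E\<^sup>*" "(y (i + 1), x i) \<in> E\<^sup>*"
        using x y walks_edge[of x E i] walks_edge[of y E i] step1
          spec[of "\<lambda>j. (x (j + 1), x j) \<in> E\<^sup>*" i] spec[of "\<lambda>j. (y (j + 1), y j) \<in> E\<^sup>*" i]
        by auto
      then show ?case using unique_return by blast
    next
      case (step2 i)
      have "(x (i - 1), x i) \<in> E" "(y (i - 1), x i) \<in> E" "(x i, x (i - 1)) \<in> E\<^sup>*" "(x i, y (i - 1)) \<in> E\<^sup>*"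
        using x y walks_edge[of x E "i - 1"] walks_edge[of y E "i - 1"] step2
          spec[of "\<lambda>j. (x (j + 1), x j) \<in> E\<^sup>*" "i - 1"] spec[of "\<lambda>j. (y (j + 1), y j) \<in> E\<^sup>*" "i - 1"]
        by auto
      then show ?case using unique_return_backward by blast
    qed
  qed
  show "(\<lambda>x. x 0) ` ?R \<subseteq> Field E" using walks_Field by auto
  show "finite (Field E)" using finite_E by (simp add: finite_Field)
qed

text \<open>\<open>reach\<close> is monotone and bounded along the walk, hence constant far to the
  left and far to the right.\<close>

lemma eventually_recurrent:
  assumes x: "x \<in> walks E"
  obtains N where "\<And>i. \<bar>i\<bar> \<ge> N \<Longrightarrow> (x (i + 1), x i) \<in> E\<^sup>*"
proof -
  obtain a where a: "\<And>i. reach (x a) \<le> reach (x i)"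
    using ex_has_least_nat[of "\<lambda>_. True" 0 "\<lambda>i. reach (x i)"] by auto
  have "reach (x i) \<le> card (Field E)" for i
    unfolding reach_def
  proof (rule card_mono)
    show "finite (Field E)" using finite_E by (simp add: finite_Field)
    show "E\<^sup>* `` {x i} \<subseteq> Field E" using walks_Field[OF x, of i] by (auto elim: rtranclE simp: Field_def)
  qed
  then obtain b where b: "\<And>i. reach (x i) \<le> reach (x b)"
    using ex_has_greatest_nat[of "\<lambda>_. True" 0 "\<lambda>i. reach (x i)" "Suc (card (Field E))"]
    by (auto simp: less_Suc_eq_le)
  define N where "N = \<bar>a\<bar> + \<bar>b\<bar> + 1"
  have "(x (i + 1), x i) \<in> E\<^sup>*" if i: "\<bar>i\<bar> \<ge> N" for i
  proof (rule reach_back)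
    show "(x i, x (i + 1)) \<in> E\<^sup>*" using walks_edge[OF x] by blast
    show "reach (x i) \<le> reach (x (i + 1))"
    proof (cases "i \<ge> 0")
      case True
      then have "reach (x i) \<le> reach (x a)"
        using i by (intro reach_mono walks_reach[OF x]) (auto simp: N_def)
      then show ?thesis using a[of "i + 1"] by linarith
    next
      case False
      then have "reach (x b) \<le> reach (x (i + 1))"
        using i by (intro reach_mono walks_reach[OF x]) (auto simp: N_def)
      then show ?thesis using b[of i] by linarith
    qed
  qed
  then show ?thesis using that by blast
qed

text \<open>Some non-isolated \<open>x\<close> has an edge without return, at \<open>i0\<close>,
  while far out on both sides it runs on cycles. A close \<open>y\<close> first differs from
  \<open>x\<close> far out. On the right it leaves the cycle that \<open>x\<close> follows, and the
  edge at \<open>i0\<close> lies before that cycle; on the left it comes into the cycle from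
  outside, and the edge at \<open>i0\<close> lies after it.\<close>

lemma chain_if_infinite_nonisolated:
  assumes "infinite {x \<in> walks E. \<forall>N. \<exists>y\<in>walks E. y \<noteq> x \<and> window_eq N x y}"
  obtains y i j k where "y \<in> walks E" "i < j" "j < k" "(y j, y j) \<in> E\<^sup>+"
    "(y j, y i) \<notin> E\<^sup>*" "(y k, y j) \<notin> E\<^sup>*"
proof -
  have "\<not> {x \<in> walks E. \<forall>N. \<exists>y\<in>walks E. y \<noteq> x \<and> window_eq N x y}
      \<subseteq> {x \<in> walks E. \<forall>i. (x (i + 1), x i) \<in> E\<^sup>*}"
    using assms finite_recurrent_walks finite_subset by blast
  then obtain x i0 where x: "x \<in> walks E" "\<And>N. \<exists>y\<in>walks E. y \<noteq> x \<and> window_eq N x y"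
    and i0: "(x (i0 + 1), x i0) \<notin> E\<^sup>*" by blast
  obtain N0 where N0: "\<And>i. \<bar>i\<bar> \<ge> N0 \<Longrightarrow> (x (i + 1), x i) \<in> E\<^sup>*" using eventually_recurrent[OF x(1)] by blast
  define N where "N = \<bar>N0\<bar> + \<bar>i0\<bar> + 2"
  obtain y where y: "y \<in> walks E" "y \<noteq> x" "window_eq N x y" using x(2) by blast
  have yx: "y i = x i" if "\<bar>i\<bar> \<le> N" for i using y(3) that by (simp add: window_eq_def)
  \<comment> \<open>Such a vertex would close a return path for the edge at
    \<open>i0\<close>.\<close>
  have jump: "\<not> ((x (i0 + 1), x k) \<in> E\<^sup>* \<and> (x k, x i0) \<in> E\<^sup>*)" for k
    using i0 by (meson rtrancl_trans)
  obtain k0 where k0: "y k0 \<noteq> x k0" using y(2) by auto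
  show ?thesis
  proof (cases "k0 \<ge> 0")
    case True
    define n where "n = (LEAST n. y (int n) \<noteq> x (int n))"
    have "y (int (nat k0)) \<noteq> x (int (nat k0))" using True k0 by simp
    then have n: "y (int n) \<noteq> x (int n)" unfolding n_def by (rule LeastI)
    have least: "y (int m) = x (int m)" if "m < n" for m using not_less_Least that unfolding n_def by blast
    define k where "k = int n"
    have nk: "y k \<noteq> x k" using n by (simp add: k_def)
    have kN: "k > N" using yx[of k] n by (cases "int n \<le> N") (auto simp: k_def)
    then have eq: "y (k - 1) = x (k - 1)" using least[of "n - 1"] by (auto simp: k_def N_def of_nat_diff)
    have ex: "(x (k - 1), x k) \<in> E" and ey: "(x (k - 1), y k) \<in> E"
      using walks_edge[OF x(1), of "k - 1"] walks_edge[OF y(1), of "k - 1"] eq by auto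
    have ret: "(x k, x (k - 1)) \<in> E\<^sup>*" using N0[of "k - 1"] kN by (simp add: N_def)
    have "(y (k - 1), y (k - 1)) \<in> E\<^sup>+" unfolding eq using ex ret by (rule rtrancl_into_trancl2)
    moreover have "(y k, y (k - 1)) \<notin> E\<^sup>*"
      unfolding eq using unique_return[OF ex ey ret] nk by auto
    moreover have "(y (k - 1), y i0) \<notin> E\<^sup>*"
      using jump[of "k - 1"] walks_reach[OF x(1), of "i0 + 1" "k - 1"] kN yx[of i0] by (auto simp: eq N_def)
    moreover have "i0 < k - 1" using kN by (simp add: N_def)
    ultimately show ?thesis using that[of y i0 "k - 1" k] y(1) by simp
  next
    case False
    define n where "n = (LEAST n. y (- int n) \<noteq> x (- int n))"
    have "y (- int (nat (- k0))) \<noteq> x (- int (nat (- k0)))" using False k0 by simp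
    then have n: "y (- int n) \<noteq> x (- int n)" unfolding n_def by (rule LeastI)
    have least: "y (- int m) = x (- int m)" if "m < n" for m using not_less_Least that unfolding n_def by blast
    define k where "k = - int n"
    have nk: "y k \<noteq> x k" using n by (simp add: k_def)
    have kN: "k < - N" using yx[of k] n by (cases "int n \<le> N") (auto simp: k_def)
    then have eq: "y (k + 1) = x (k + 1)" using least[of "n - 1"] by (auto simp: k_def N_def of_nat_diff)
    have ex: "(x k, x (k + 1)) \<in> E" and ey: "(y k, x (k + 1)) \<in> E"
      using walks_edge[OF x(1), of k] walks_edge[OF y(1), of k] eq by auto
    have ret: "(x (k + 1), x k) \<in> E\<^sup>*" using N0[of k] kN by (simp add: N_def)
    have "(y (k + 1), y (k + 1)) \<in> E\<^sup>+" unfolding eq using ret ex by (rule rtrancl_into_trancl1)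
    moreover have "(y (k + 1), y k) \<notin> E\<^sup>*"
      unfolding eq using unique_return_backward[OF ex ey ret] nk by auto
    moreover have "(y (i0 + 1), y (k + 1)) \<notin> E\<^sup>*"
      using jump[of "k + 1"] walks_reach[OF x(1), of "k + 1" i0] kN yx[of "i0 + 1"] by (auto simp: eq N_def)
    moreover have "k + 1 < i0 + 1" using kN by (simp add: N_def)
    ultimately show ?thesis using that[of y k "k + 1" "i0 + 1"] y(1) by simp
  qed
qed

lemma walk_through:
  assumes "(a, b) \<in> E\<^sup>*" "a \<in> Field E"
  shows "\<exists>w\<in>walks E. \<exists>n. w 0 = a \<and> w (int n) = b"
  using assms(1)
proof (induction rule: rtrancl_induct)
  case base
  from assms(2) consider c where "(a, c) \<in> E" | c where "(c, a) \<in> E" by (auto simp: Field_def)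
  then show ?case
  proof cases
    case 1
    then obtain x where "x \<in> walks E" "x 0 = a" using extend by blast
    then show ?thesis by (intro bexI[of _ x] exI[of _ 0]) auto
  next
    case 2
    then obtain x where "x \<in> walks E" "x 1 = a" using extend by blast
    then show ?thesis using shift_by_walks[of x E 1]
      by (intro bexI[of _ "shift_by 1 x"] exI[of _ 0]) (auto simp: shift_by_def)
  qed
next
  case (step b c)
  then obtain w n where w: "w \<in> walks E" "w 0 = a" "w (int n) = b" by blast
  obtain e where e: "e \<in> walks E" "e 0 = b" "e 1 = c" using extend step by blast
  let ?w = "\<lambda>i. if i \<ge> int n then shift_by (- int n) e i else w i"
  have "?w \<in> walks E"
    using splice_walks[OF w(1) shift_by_walks[OF e(1)]] w e by (simp add: shift_by_def)
  moreover have "?w 0 = a" "?w (int (Suc n)) = c" using w e by (auto simp: shift_by_def)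
  ultimately show ?case by (intro bexI[of _ ?w] exI[of _ "Suc n"]) blast+
qed

lemma periodic_walk:
  assumes "(u, u) \<in> E\<^sup>+"
  obtains Y L where "Y \<in> walks E" "L > 0" "Y 0 = u" "\<And>k m. Y (k + m * L) = Y k"
proof -
  obtain a where a: "(u, a) \<in> E" "(a, u) \<in> E\<^sup>*" using tranclD[OF assms] by blast
  obtain w n where w: "w \<in> walks E" "w 0 = a" "w (int n) = u"
    using walk_through[OF a(2)] a(1) by (auto simp: Field_def)
  obtain e where e: "e \<in> walks E" "e 0 = u" "e 1 = a" using extend a by blast
  define g where "g = (\<lambda>i. if i \<ge> 1 then shift_by (- 1) w i else e i)"
  have g: "g \<in> walks E" unfolding g_def
    by (rule splice_walks[OF e(1) shift_by_walks[OF w(1)]]) (use w e in \<open>auto simp: shift_by_def\<close>)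
  define L where "L = int n + 1"
  have L: "L > 0" "g 0 = u" "g L = u" using w e by (auto simp: g_def L_def shift_by_def)
  define Y where "Y k = g (k mod L)" for k
  have "Y \<in> walks E"
    unfolding walks_def
  proof (intro CollectI allI)
    fix k
    have "Y (k + 1) = g (k mod L + 1)"
    proof (cases "k mod L + 1 = L")
      case True
      then have "(k + 1) mod L = 0" by (metis mod_add_left_eq mod_self)
      then show ?thesis using True L by (simp add: Y_def)
    next
      case False
      then have "(k + 1) mod L = k mod L + 1"
        using L by (smt (verit) mod_add_left_eq mod_pos_pos_trivial pos_mod_bound pos_mod_sign)
      then show ?thesis by (simp add: Y_def)
    qed
    then show "(Y k, Y (k + 1)) \<in> E" using walks_edge[OF g, of "k mod L"] by (simp add: Y_def)
  qed
  moreover have "Y 0 = u" "\<And>k m. Y (k + m * L) = Y k" using L by (auto simp: Y_def)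
  ultimately show ?thesis using that L(1) by blast
qed

text \<open>\<open>x0\<close> turns around the cycle of \<open>u\<close> and then moves to a sink
  component \<open>C\<close>, which exists since the cycle can be left. The past of
  \<open>y\<close>, which reaches the cycle from outside, supplies the walk \<open>z\<close> that
  has turned only finitely often.\<close>

lemma collapsible_if_chain:
  assumes y: "y \<in> walks E" and ijk: "i < j" "j < k" and rec: "(y j, y j) \<in> E\<^sup>+"
    and entry: "(y j, y i) \<notin> E\<^sup>*" and exit: "(y k, y j) \<notin> E\<^sup>*"
  shows "collapsible (walks E)"
proof -
  define u where "u = y j"
  \<comment> \<open>Minimality of the set reachable from \<open>b\<close> makes it a cycle that cannot be left.\<close>
  have "(u, y k) \<in> E\<^sup>* \<and> (y k, u) \<notin> E\<^sup>*" using walks_reach[OF y, of j k] ijk exit by (simp add: u_def)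
  then obtain b where b: "(u, b) \<in> E\<^sup>*" "(b, u) \<notin> E\<^sup>*"
    and b_min: "\<And>c. (u, c) \<in> E\<^sup>* \<Longrightarrow> (c, u) \<notin> E\<^sup>* \<Longrightarrow> reach b \<le> reach c"
    using ex_has_least_nat[of "\<lambda>b. (u, b) \<in> E\<^sup>* \<and> (b, u) \<notin> E\<^sup>*" "y k" reach] by metis
  define C where "C = E\<^sup>* `` {b}"
  have C_back: "(c, b) \<in> E\<^sup>*" if "c \<in> C" for c
  proof -
    have bc: "(b, c) \<in> E\<^sup>*" using that by (simp add: C_def)
    have "(u, c) \<in> E\<^sup>*" using b(1) bc by simp
    moreover have "(c, u) \<notin> E\<^sup>*" using b(2) bc by (meson rtrancl_trans)
    ultimately show ?thesis using reach_back[OF bc] b_min by blast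
  qed
  have sink: "d \<in> C" if "c \<in> C" "(c, d) \<in> E" for c d using that by (auto simp: C_def)
  have ret: "(d, c) \<in> E\<^sup>*" if "c \<in> C" "d \<in> C" for c d
    using C_back[OF that(2)] that(1) by (auto simp: C_def)
  have det: "d = e" if "c \<in> C" "(c, d) \<in> E" "(c, e) \<in> E" for c d e
    using unique_return[OF that(2,3)] ret sink that by blast
  have uC: "u \<notin> C" using b(2) by (simp add: C_def)
  obtain w n where w: "w \<in> walks E" "w 0 = u" "w (int n) = b"
    using walk_through[OF b(1)] walks_Field[OF y] by (auto simp: u_def)
  have w_sink: "w l \<in> C" if "w k \<in> C" "k \<le> l" for k l
    using walks_reach[OF w(1) that(2)] that(1) by (auto simp: C_def)
  \<comment> \<open>The first time \<open>w\<close> is in \<open>C\<close>; shifting by it puts the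
    entry of \<open>x0\<close> at time 0.\<close>
  define m where "m = (LEAST m. w (int m) \<in> C)"
  have m: "w (int m) \<in> C" unfolding m_def by (rule LeastI[of _ n]) (simp add: w C_def)
  have m_min: "w (int l) \<notin> C" if "l < m" for l using not_less_Least that unfolding m_def by blast
  obtain Y L where Y: "Y \<in> walks E" "L > 0" "Y 0 = u" "\<And>k m. Y (k + m * L) = Y k"
    using periodic_walk rec unfolding u_def by blast
  \<comment> \<open>Adding or subtracting enough periods \<open>L\<close> places the time on either
    side of 0, where \<open>Y\<close> is at \<open>u\<close>.\<close>
  have uY: "(u, Y l) \<in> E\<^sup>*" and Yu: "(Y l, u) \<in> E\<^sup>*" for l
  proof -
    have "\<bar>l\<bar> \<le> \<bar>l\<bar> * L" using Y(2) by (simp add: mult_le_cancel_left1)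
    then have "0 \<le> l + \<bar>l\<bar> * L" "l + - \<bar>l\<bar> * L \<le> 0" by (auto simp: abs_le_iff)
    then show "(u, Y l) \<in> E\<^sup>*" "(Y l, u) \<in> E\<^sup>*"
      using walks_reach[OF Y(1), of 0 "l + \<bar>l\<bar> * L"] walks_reach[OF Y(1), of "l + - \<bar>l\<bar> * L" 0]
      unfolding Y(3,4) by blast+
  qed
  define x0 where "x0 = (\<lambda>i. if i \<ge> - int m then shift_by (int m) w i else shift_by (int m) Y i)"
  have x0: "x0 \<in> walks E" unfolding x0_def
    by (rule splice_walks[OF shift_by_walks[OF Y(1)] shift_by_walks[OF w(1)]])
       (use w Y in \<open>auto simp: shift_by_def\<close>)
  have x0_left: "x0 l = Y (l + int m)" if "l \<le> - int m" for l
    using that w Y by (auto simp: x0_def shift_by_def)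
  have x0_C: "x0 l \<in> C \<longleftrightarrow> l \<ge> 0" for l
  proof (cases "l \<ge> - int m")
    case True
    then show ?thesis
      using w_sink[OF m, of "l + int m"] m_min[of "nat (l + int m)"]
      by (cases "l \<ge> 0") (auto simp: x0_def shift_by_def)
  next
    case False
    have "Y (l + int m) \<notin> C" using Yu[of "l + int m"] b(2) unfolding C_def
      by (meson Image_singleton_iff rtrancl_trans)
    then show ?thesis using False x0_left[of l] by simp
  qed
  have "(x0 0, x0 0) \<in> E\<^sup>+"
    using walks_edge[OF x0, of 0] ret[of "x0 0" "x0 1"] x0_C by (simp add: rtrancl_into_trancl2)
  then obtain Z M where Z: "Z \<in> walks E" "M > 0" "Z 0 = x0 0" "\<And>k m. Z (k + m * M) = Z k"
    using periodic_walk by blast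
  have x0_right: "x0 l = Z l" if "l \<ge> 0" for l
    using that
  proof (induction l rule: int_ge_induct)
    case base
    show ?case using Z by simp
  next
    case (step l)
    have "(x0 l, x0 (l + 1)) \<in> E" "(x0 l, Z (l + 1)) \<in> E"
      using walks_edge[OF x0, of l] walks_edge[OF Z(1), of l] step by auto
    moreover have "x0 l \<in> C" using step.hyps x0_C by blast
    ultimately show ?case using det by blast
  qed
  \<comment> \<open>A common multiple of the periods \<open>L\<close> before the transition and
    \<open>M\<close> inside \<open>C\<close>.\<close>
  define P where "P = L * M"
  have P: "P > 0" using Y Z by (simp add: P_def)
  have left: "x0 (l - P) = x0 l" if "l \<le> - int m" for l
    using x0_left[of l] x0_left[of "l - P"] that P Y(4)[of "l + int m" "- M"] by (simp add: P_def algebra_simps)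
  have right: "x0 (l + P) = x0 l" if "l \<ge> 0" for l
    using x0_right[of l] x0_right[of "l + P"] that P Z(4)[of l L] by (simp add: P_def)
  \<comment> \<open>A time on the left cycle, a full \<open>P\<close> before the transition starts,
    at which \<open>x0\<close> is at \<open>u\<close>, so that \<open>y\<close> up to time
    \<open>j\<close> can be glued on.\<close>
  define t where "t = - int m - P"
  define z where "z = (\<lambda>l. if l \<ge> t then x0 l else shift_by (j - t) y l)"
  have "x0 t = Y (- P)" using x0_left[of t] P by (simp add: t_def)
  also have "\<dots> = u" using Y(4)[of 0 "- M"] Y(3) by (simp add: P_def algebra_simps)
  finally have x0t: "x0 t = u" .
  have z: "z \<in> walks E" unfolding z_def
    by (rule splice_walks[OF shift_by_walks[OF y] x0]) (simp add: shift_by_def x0t u_def)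
  have z_eq: "z l = x0 l" if "l \<ge> t" for l using that by (simp add: z_def)
  have "z (t - (j - i)) = y i" using ijk by (simp add: z_def shift_by_def)
  moreover have "(u, x0 (t - (j - i))) \<in> E\<^sup>*" using x0_left[of "t - (j - i)"] uY ijk P by (simp add: t_def)
  \<comment> \<open>At this time \<open>x0\<close> is on the cycle of \<open>u\<close>, whereas
    \<open>z\<close> is at \<open>y i\<close>, which cannot be reached from
    \<open>u\<close>.\<close>
  ultimately have neq: "z (t - int (nat (j - i))) \<noteq> x0 (t - int (nat (j - i)))"
    using entry ijk by (auto simp: u_def)
  define n0 where "n0 = (LEAST n. z (t - int n) \<noteq> x0 (t - int n))"
  define c where "c = t - int n0"
  have c: "z c \<noteq> x0 c" unfolding c_def n0_def by (rule LeastI[of _ "nat (j - i)"]) (rule neq)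
  have c_max: "z l = x0 l" if "l > c" for l
  proof (cases "l \<ge> t")
    case False
    then have "nat (t - l) < n0" using that by (simp add: c_def)
    then have "z (t - int (nat (t - l))) = x0 (t - int (nat (t - l)))"
      unfolding n0_def using not_less_Least by blast
    then show ?thesis using False by simp
  qed (rule z_eq)
  have ct: "c < t" using c z_eq by (meson not_le)
  \<comment> \<open>With \<open>T\<close> equal to \<open>- c - 1 - P\<close>, the last disagreement
    \<open>c\<close> is the last time before \<open>- T - P\<close>. From \<open>c < t\<close> it
    follows that \<open>T\<close> is at least \<open>m\<close>, so \<open>x0\<close> is periodic up
    to \<open>- T\<close>.\<close>
  have "- (- c - 1 - P) - 2 * P \<le> c \<and> c < - (- c - 1 - P) - P \<and> z c \<noteq> x0 c"
    using c P by simp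
  then have "\<exists>i. - (- c - 1 - P) - 2 * P \<le> i \<and> i < - (- c - 1 - P) - P \<and> z i \<noteq> x0 i" by blast
  then have "sink_entry E C x0 z P (- c - 1 - P)"
    using sink det x0 x0_C P ct left right z c_max by unfold_locales (auto simp: t_def)
  then show ?thesis by (rule sink_entry.collapsible)
qed

end

section \<open>Recoding by windows\<close>

text \<open>The map is transported by conjugation with \<phi>. The radii \<open>m\<close> and
  \<open>M\<close> add up, and the inverse of \<phi> costs nothing because it reads a single
  symbol.\<close>

lemma collapsible_conjugate:
  assumes \<phi>: "bij_betw \<phi> X Y" "\<And>x. x \<in> X \<Longrightarrow> \<phi> (shift x) = shift (\<phi> x)"
    and X: "\<And>x. x \<in> X \<Longrightarrow> shift x \<in> X"
    and \<phi>_local: "\<And>x y i. x \<in> X \<Longrightarrow> y \<in> X \<Longrightarrow> (\<And>k. \<bar>k - i\<bar> \<le> m \<Longrightarrow> x k = y k) \<Longrightarrow> \<phi> x i = \<phi> y i"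
    and \<phi>_inv_local: "\<And>x y i. x \<in> X \<Longrightarrow> y \<in> X \<Longrightarrow> \<phi> x i = \<phi> y i \<Longrightarrow> x i = y i"
    and Y: "collapsible Y"
  shows "collapsible X"
proof -
  obtain \<tau> M where \<tau>: "\<tau> ` Y = Y" "\<And>y. y \<in> Y \<Longrightarrow> \<tau> (shift y) = shift (\<tau> y)" "\<not> inj_on \<tau> Y"
    and M: "\<And>x y i. x \<in> Y \<Longrightarrow> y \<in> Y \<Longrightarrow> (\<And>k. \<bar>k - i\<bar> \<le> M \<Longrightarrow> x k = y k) \<Longrightarrow> \<tau> x i = \<tau> y i"
    using Y unfolding collapsible_def sliding_block_endo_def by metis
  define \<psi> where "\<psi> = inv_into X \<phi>"
  have \<psi>: "\<psi> y \<in> X" "\<phi> (\<psi> y) = y" if "y \<in> Y" for y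
    using that \<phi>(1) by (auto simp: \<psi>_def bij_betw_def inv_into_into f_inv_into_f)
  have \<phi>Y: "\<phi> x \<in> Y" "\<psi> (\<phi> x) = x" if "x \<in> X" for x
    using that \<phi>(1) by (auto simp: \<psi>_def bij_betw_def)
  have \<tau>Y: "\<tau> y \<in> Y" if "y \<in> Y" for y using \<tau>(1) that by blast
  define \<rho> where "\<rho> x = \<psi> (\<tau> (\<phi> x))" for x
  have "\<rho> ` X = \<psi> ` (\<tau> ` (\<phi> ` X))" by (auto simp: \<rho>_def image_image)
  also have "\<phi> ` X = Y" using \<phi>(1) by (simp add: bij_betw_def)
  also have "\<psi> ` (\<tau> ` Y) = X" unfolding \<tau>(1) using \<psi> \<phi>Y by (force simp: image_iff)
  finally have surj: "\<rho> ` X = X" .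
  have equi: "\<rho> (shift x) = shift (\<rho> x)" if x: "x \<in> X" for x
  proof -
    have "\<phi> (shift (\<rho> x)) = shift (\<tau> (\<phi> x))"
      using \<phi>(2) \<psi> \<tau>Y \<phi>Y x by (simp only: \<rho>_def)
    also have "\<dots> = \<tau> (\<phi> (shift x))" using \<tau>(2) \<phi>(2) \<phi>Y x by (simp only:)
    finally have "\<rho> (shift x) = \<psi> (\<phi> (shift (\<rho> x)))" by (simp only: \<rho>_def)
    moreover have "shift (\<rho> x) \<in> X" using X surj x by blast
    ultimately show ?thesis using \<phi>Y by (simp only:)
  qed
  have loc: "\<rho> x i = \<rho> y i" if xy: "x \<in> X" "y \<in> X" and eq: "\<And>k. \<bar>k - i\<bar> \<le> m + M \<Longrightarrow> x k = y k" for x y i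
  proof (rule \<phi>_inv_local)
    show "\<rho> x \<in> X" "\<rho> y \<in> X" using surj xy by auto
    have "\<tau> (\<phi> x) i = \<tau> (\<phi> y) i"
    proof (rule M)
      fix k assume "\<bar>k - i\<bar> \<le> M"
      then show "\<phi> x k = \<phi> y k" using eq by (intro \<phi>_local[OF xy]) auto
    qed (use \<phi>Y xy in auto)
    then show "\<phi> (\<rho> x) i = \<phi> (\<rho> y) i" using \<psi> \<tau>Y \<phi>Y xy by (simp add: \<rho>_def)
  qed
  have "\<not> inj_on \<rho> X"
  proof
    assume inj: "inj_on \<rho> X"
    have "inj_on \<tau> Y"
    proof (rule inj_onI)
      fix a b assume ab: "a \<in> Y" "b \<in> Y" "\<tau> a = \<tau> b"
      then have "\<rho> (\<psi> a) = \<rho> (\<psi> b)" using \<psi> by (simp add: \<rho>_def)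
      then have "\<psi> a = \<psi> b" using inj \<psi> ab by (auto dest: inj_onD)
      then show "a = b" using \<psi>(2) ab by metis
    qed
    then show False using \<tau>(3) by simp
  qed
  moreover have "sliding_block_endo X \<rho>"
    unfolding sliding_block_endo_def using surj equi loc by (metis order_refl)
  ultimately show ?thesis using surj by (auto simp: collapsible_def)
qed

text \<open>The higher block presentation. With length \<open>n + 1\<close> the symbol at
  \<open>i\<close> is readable even for \<open>n = 0\<close>, and the tail of a window is exactly
  the word tested in \<open>finite_type\<close>.\<close>

definition windows :: "nat \<Rightarrow> (int \<Rightarrow> 'a) \<Rightarrow> int \<Rightarrow> 'a list" where
  "windows n x = (\<lambda>i. map (\<lambda>k. x (i + int k)) [0..<Suc n])"

text \<open>Only pairs that occur in a point of \<open>X\<close> are edges, so every edge lies on a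
  bi-infinite walk.\<close>

definition window_graph :: "nat \<Rightarrow> (int \<Rightarrow> 'a) set \<Rightarrow> ('a list \<times> 'a list) set" where
  "window_graph n X = {(windows n x i, windows n x (i + 1)) | x i. x \<in> X}"

lemma length_windows [simp]: "length (windows n x i) = Suc n"
  by (simp add: windows_def)

lemma nth_windows: "k \<le> n \<Longrightarrow> windows n x i ! k = x (i + int k)"
  by (simp add: windows_def nth_append less_Suc_eq_le del: upt_Suc)

lemma windows_shift_by: "windows n (shift_by m x) = shift_by m (windows n x)"
  by (simp add: windows_def shift_by_def algebra_simps)

lemma windows_walks: "x \<in> X \<Longrightarrow> windows n x \<in> walks (window_graph n X)"
  by (auto simp: walks_def window_graph_def)

lemma inj_windows: "windows n x = windows n y \<Longrightarrow> x = y"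
  using nth_windows[of 0 n] by (metis ext add_0_right of_nat_0 zero_le)

text \<open>Consecutive vertices overlap, so a walk spells a sequence \<open>x\<close>. Each test on
  \<open>x\<close> concerns a single window, which occurs in some point of \<open>X\<close>; finite
  type then puts \<open>x\<close> itself into \<open>X\<close>.\<close>

lemma windows_bij_betw:
  assumes S: "X = {x \<in> topspace (full_shift A). \<forall>i. map (\<lambda>k. x (i + int k)) [1..<Suc n] \<in> S}"
  shows "bij_betw (windows n) X (walks (window_graph n X))"
  unfolding bij_betw_def
proof (intro conjI set_eqI iffI)
  show "inj_on (windows n) X" using inj_windows by (auto intro: inj_onI)
  show "f \<in> walks (window_graph n X)" if "f \<in> windows n ` X" for f using that windows_walks by blast
  fix f assume f: "f \<in> walks (window_graph n X)"
  have tl_windows: "tl (windows n x i) = map (\<lambda>k. x (i + int k)) [1..<Suc n]" for x i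
    by (simp add: windows_def upt_conv_Cons del: upt_Suc)
  have edge: "\<exists>x\<in>X. \<exists>j. f i = windows n x j \<and> f (i + 1) = windows n x (j + 1)" for i
    using walks_edge[OF f, of i] by (auto simp: window_graph_def)
  have step: "f i ! Suc k = f (i + 1) ! k" if k: "Suc k \<le> n" for i k
  proof -
    obtain x j where "f i = windows n x j" "f (i + 1) = windows n x (j + 1)" using edge by blast
    then show ?thesis using k by (simp add: nth_windows algebra_simps)
  qed
  define x where "x i = f i ! 0" for i
  have nth: "f i ! k = x (i + int k)" if "k \<le> n" for i k
    using that
  proof (induction k arbitrary: i)
    case (Suc k)
    then show ?case using step[of k i] by (simp add: algebra_simps)
  qed (simp add: x_def)
  have fx: "f i = windows n x i" for i
  proof (rule nth_equalityI)
    obtain y j where "f i = windows n y j" using edge by blast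
    then show "length (f i) = length (windows n x i)" by simp
    show "f i ! k = windows n x i ! k" if "k < length (f i)" for k
      using that \<open>length (f i) = length (windows n x i)\<close> by (simp add: nth nth_windows)
  qed
  have "x i \<in> A \<and> map (\<lambda>k. x (i + int k)) [1..<Suc n] \<in> S" for i
  proof -
    obtain y j where y: "y \<in> X" "f i = windows n y j" using edge by blast
    have "y \<in> topspace (full_shift A)" "map (\<lambda>k. y (j + int k)) [1..<Suc n] \<in> S"
      using y(1) unfolding S by blast+
    moreover have "x i = y j" using y(2) by (simp add: x_def nth_windows)
    moreover have "map (\<lambda>k. x (i + int k)) [1..<Suc n] = map (\<lambda>k. y (j + int k)) [1..<Suc n]"
      unfolding tl_windows[symmetric] fx[symmetric] y(2) ..
    ultimately show ?thesis by (auto simp: topspace_full_shift simp del: upt_Suc map_eq_conv)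
  qed
  then have "x \<in> X" unfolding S by (auto simp: topspace_full_shift simp del: upt_Suc)
  moreover have "f = windows n x" using fx by blast
  ultimately show "f \<in> windows n ` X" by blast
qed

lemma finite_window_graph:
  assumes "finite A" "X \<subseteq> topspace (full_shift A)"
  shows "finite (window_graph n X)"
proof -
  let ?W = "{w. set w \<subseteq> A \<and> length w = Suc n}"
  have "windows n x i \<in> ?W" if "x \<in> X" for x i
    using that assms(2) by (auto simp: windows_def topspace_full_shift)
  then have "window_graph n X \<subseteq> ?W \<times> ?W" by (auto simp: window_graph_def)
  then show ?thesis using finite_lists_length_eq[OF assms(1)] by (meson finite_SigmaI finite_subset)
qed

lemma collapsible_if_infinite_nonisolated:
  assumes A: "finite A" and X: "subshift A X" "finite_type A X"
    and inf: "infinite (nonisolated (subshift_topology A X))"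
  shows "collapsible X"
proof -
  obtain n S where S: "X = {x \<in> topspace (full_shift A). \<forall>i. map (\<lambda>k. x (i + int k)) [1..<Suc n] \<in> S}"
    using X(2) unfolding finite_type_def by blast
  have XA: "X \<subseteq> topspace (full_shift A)" and shX: "shift ` X = X"
    using X(1) closedin_subset by (auto simp: subshift_def)
  define E where "E = window_graph n X"
  have bij: "bij_betw (windows n) X (walks E)" unfolding E_def using S by (rule windows_bij_betw)
  have "infinite {x \<in> walks E. \<forall>N. \<exists>y\<in>walks E. y \<noteq> x \<and> window_eq N x y}" (is "infinite ?I")
  proof
    assume "finite ?I"
    moreover have "windows n ` nonisolated (subshift_topology A X) \<subseteq> ?I"
    proof (intro image_subsetI CollectI conjI allI)
      fix x N assume "x \<in> nonisolated (subshift_topology A X)"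
      then have x: "x \<in> X" "\<And>N. \<exists>y\<in>X. y \<noteq> x \<and> window_eq N x y"
        unfolding nonisolated_subshift_topology[OF XA] by auto
      show "windows n x \<in> walks E" using x(1) windows_walks unfolding E_def by blast
      \<comment> \<open>A window starting within \<open>N\<close> of the origin reads up to
        \<open>n\<close> further coordinates to the right.\<close>
      obtain y where y: "y \<in> X" "y \<noteq> x" "window_eq (N + int n) x y" using x(2) by blast
      have "windows n x i = windows n y i" if "\<bar>i\<bar> \<le> N" for i
        using y(3) that by (auto simp: windows_def window_eq_def)
      then have "window_eq N (windows n x) (windows n y)" by (simp add: window_eq_def)
      moreover have "windows n y \<noteq> windows n x" using y(2) inj_windows by blast
      moreover have "windows n y \<in> walks E" using y(1) windows_walks unfolding E_def by blast
      ultimately show "\<exists>y\<in>walks E. y \<noteq> windows n x \<and> window_eq N (windows n x) y" by blast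
    qed
    ultimately have "finite (windows n ` nonisolated (subshift_topology A X))" by (rule rev_finite_subset)
    then have "finite (nonisolated (subshift_topology A X))"
      by (rule finite_imageD) (use inj_windows in \<open>auto intro: inj_onI\<close>)
    then show False using inf by simp
  qed
  note infinite = this
  have "collapsible (walks E)"
  proof (cases "\<exists>v a b. (v, a) \<in> E \<and> (v, b) \<in> E \<and> a \<noteq> b \<and> (a, v) \<in> E\<^sup>* \<and> (b, v) \<in> E\<^sup>*")
    case True
    then show ?thesis by (elim exE conjE) (rule collapsible_if_branching)
  next
    case False
    interpret deterministic_graph E
    proof
      show "finite E" unfolding E_def using A XA by (rule finite_window_graph)
      show "\<exists>x\<in>walks E. x 0 = a \<and> x 1 = b" if "(a, b) \<in> E" for a b
      proof -
        obtain x i where x: "x \<in> X" "a = windows n x i" "b = windows n x (i + 1)"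
          using \<open>(a, b) \<in> E\<close> by (auto simp: E_def window_graph_def)
        have "shift_by i (windows n x) \<in> walks E"
          using shift_by_walks windows_walks[OF x(1)] unfolding E_def by blast
        then show ?thesis using x by (intro bexI[of _ "shift_by i (windows n x)"]) (auto simp: shift_by_def algebra_simps)
      qed
    qed (use False in blast)
    show ?thesis using chain_if_infinite_nonisolated[OF infinite] collapsible_if_chain by metis
  qed
  note walks = this
  show ?thesis
  proof (rule collapsible_conjugate[OF bij _ _ _ _ walks, where m = "int n"])
    show "windows n (shift x) = shift (windows n x)" for x :: "int \<Rightarrow> 'a" by (simp add: windows_shift_by)
    show "shift x \<in> X" if "x \<in> X" for x using shX that by blast
    show "windows n x i = windows n y i" if "\<And>k. \<bar>k - i\<bar> \<le> int n \<Longrightarrow> x k = y k" for x y :: "int \<Rightarrow> 'a" and i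
      using that by (auto simp: windows_def)
    show "x i = y i" if "windows n x i = windows n y i" for x y :: "int \<Rightarrow> 'a" and i
      using nth_windows[of 0 n x i] nth_windows[of 0 n y i] that by simp
  qed
qed

section \<open>The topological characterisation and its consequence\<close>

theorem injunctive_iff_finite_nonisolated:
  assumes "finite A" "subshift A X" "finite_type A X"
  shows "injunctive A X \<longleftrightarrow> finite (nonisolated (subshift_topology A X))"
proof
  assume inj: "injunctive A X"
  show "finite (nonisolated (subshift_topology A X))"
  proof (rule ccontr)
    assume "infinite (nonisolated (subshift_topology A X))"
    then obtain \<tau> where \<tau>: "sliding_block_endo X \<tau>" "\<tau> ` X = X" "\<not> inj_on \<tau> X"
      using collapsible_if_infinite_nonisolated[OF assms] by (auto simp: collapsible_def)
    moreover have "X \<subseteq> topspace (full_shift A)"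
      using assms(2) closedin_subset by (auto simp: subshift_def)
    ultimately show False
      using inj sliding_block_endo_imp_endomorphism unfolding injunctive_def by blast
  qed
qed (use injunctive_if_finite_nonisolated[OF assms(1,2)] in blast)

theorem corollary1p4:
  fixes A :: "'a set" and B :: "'b set"
    and X :: "(int \<Rightarrow> 'a) set" and Y :: "(int \<Rightarrow> 'b) set"
  assumes "finite A" and "finite B"
    and "subshift A X" and "finite_type A X"
    and "subshift B Y" and "finite_type B Y"
    and "subshift_topology A X homeomorphic_space subshift_topology B Y"
  shows "injunctive A X \<longleftrightarrow> injunctive B Y"
  using injunctive_iff_finite_nonisolated[OF assms(1,3,4)]
    injunctive_iff_finite_nonisolated[OF assms(2,5,6)]
    finite_nonisolated_homeomorphic[OF assms(7)] by simp

end
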